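(* For $k\ge1$ let $P_k$ be the open polygon defined in the context; in particular $P_1$ is the open parallelogram with vertices $(1/3,2/3),(1/2,1),(2/3,1/3),(1/2,0)$. (1) The only cycles of the baker's map which do not intersect $P_1$ are of the form $(10^n)^\infty$, $(01^n)^\infty$, $(1^n0^n)^\infty$ or $(0^n10^n1^n01^n)^\infty$ with $n\ge1$. All of these intersect $\overline{P_1}$. Hence $P_1$ is a cycle trap. (2) For every $k\ge2$, the only cycles of the baker's map which do not intersect $P_k$ are of the form $(10^n)^\infty$, $(01^n)^\infty$, $(1^n0^n)^\infty$ or $(0^n10^n1^n01^n)^\infty$ with $n\ge1$, or are contained in the Cantor set $\{01,001,011,0011\}^*$. Cycles of the form $(10^n)^\infty$, $(01^n)^\infty$, $(1^n0^n)^\infty$ or $(0^n10^n1^n01^n)^\infty$ with $n\ge2$ intersect $\overline{P_k}$ for every $k\ge2$.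
   Context: Let $X=[0,1]^2$. The baker's map is $B(x,y)=(2x,\frac y2)$ if $0\le x<\frac12$ and $B(x,y)=(2x-1,\frac{y+1}2)$ if $\frac12\le x<1$. For a bi-infinite sequence $u=(x_n)_{n\in\mathbb Z}\in\{0,1\}^{\mathbb Z}$, written $\dots x_{-1}x_0\cdot x_1x_2\dots$, put $\pi(u)=\left(\sum_{n\ge1}x_n2^{-n},\ \sum_{n\ge0}x_{-n}2^{-n-1}\right)$. The map $\pi$ conjugates the left shift $\sigma$ and $B$; points and sequences are used interchangeably, so the $B$-orbit of the point $\pi(u)$ is $(\pi(\sigma^n u))_{n\in\mathbb Z}$. For $H\subset X$ the survivor set is $\mathcal J(H)=\{\pi(u): \pi(\sigma^nu)\notin H\ \text{for all } n\in\mathbb Z\}$. A cycle is a periodic orbit of $B$ other than the fixed points $(0,0)$ and $(1,1)$; for a finite word $w$, the cycle $w^\infty$ is the orbit of the point coded by the periodic bi-infinite sequence $\dots www\dots$. An open set $H$ is a cycle trap if $\mathcal J(\overline H)$ contains no cycles. For a finite set $W$ of words, $W^*$ denotes here the set of all bi-infinite sequences which are concatenations of words from $W$. The Thue–Morse word $t_0t_1t_2\dots=01101001\dots$ is given by $t_0=0$, $t_{2m}=t_m$, $t_{2m+1}=1-t_m$. For $k\ge1$, $\boldsymbol t_k\in(0,1/2)$ is the number with binary expansion $0.(t_0t_1\dots t_{2^k-1})^\infty$ (e.g. $\boldsymbol t_1=1/3$, $\boldsymbol t_2=2/5$), and $$P_k=\{(x,y)\in X:\ 2x-1<y<2x,\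 \ 2-4x<y<3-4x,\ \ \boldsymbol t_k<x<1-\boldsymbol t_k\}.$$
   Formalization: The last sentence of (2) is false for the cycle (1^2 0^2)^∞ when k≥3 (its abscissae are 1/5, 2/5, 3/5, 4/5, but t_k>2/5), so the theorem excludes exactly this cycle for k≥3; every other case of the sentence is kept. *)

theory Defs
  imports "HOL-Analysis.Analysis" "HOL-Library.Z2"
begin

definition unit_square :: "(real \<times> real) set" where
  "unit_square = {0..1} \<times> {0..1}"

text \<open>The formula for the right half is also used on the edge \<open>x = 1\<close>, where the usual definition
  of the baker's map is silent. This makes \<open>(1,1)\<close> a fixed point and creates no other
  periodic point.\<close>

definition baker :: "real \<times> real \<Rightarrow> real \<times> real" where
  "baker = (\<lambda>(x, y). if x < 1/2 then (2 * x, y / 2) else (2 * x - 1, (y + 1) / 2))"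

text \<open>Forward orbit; for a periodic point this is the whole orbit.\<close>

definition baker_orbit :: "real \<times> real \<Rightarrow> (real \<times> real) set" where
  "baker_orbit p = range (\<lambda>k. (baker ^^ k) p)"

definition is_cycle :: "(real \<times> real) set \<Rightarrow> bool" where
  "is_cycle C \<longleftrightarrow>
     (\<exists>p\<in>unit_square. (\<exists>n\<ge>1. (baker ^^ n) p = p) \<and> C = baker_orbit p)
     \<and> C \<noteq> {(0, 0)} \<and> C \<noteq> {(1, 1)}"

definition digit :: "bit \<Rightarrow> real" where
  "digit b = of_bool (b = 1)"

text \<open>Bi-infinite sequences \<open>\<dots> x\<^sub>-\<^sub>1 x\<^sub>0 \<cdot> x\<^sub>1 x\<^sub>2 \<dots>\<close> are functions on \<open>int\<close>; \<open>shift m\<close> is the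
  \<open>m\<close>-th power of the left shift, and \<open>coding\<close> is the map usually called \<open>\<pi>\<close>.\<close>

definition shift :: "int \<Rightarrow> (int \<Rightarrow> bit) \<Rightarrow> (int \<Rightarrow> bit)" where
  "shift m u = (\<lambda>n. u (n + m))"

definition coding :: "(int \<Rightarrow> bit) \<Rightarrow> real \<times> real" where
  "coding u = (\<Sum>n. digit (u (int n + 1)) / 2 ^ (n + 1), \<Sum>n. digit (u (- int n)) / 2 ^ (n + 1))"

definition survivor_set :: "(real \<times> real) set \<Rightarrow> (real \<times> real) set" where
  "survivor_set H = {coding u | u. \<forall>m. coding (shift m u) \<notin> H}"

definition cycle_trap :: "(real \<times> real) set \<Rightarrow> bool" where
  "cycle_trap H \<longleftrightarrow> openin (top_of_set unit_square) H
     \<and> \<not> (\<exists>C. is_cycle C \<and> C \<subseteq> survivor_set (closure H))"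

text \<open>The sequence \<open>\<dots>www\<dots>\<close>, aligned so that a copy of \<open>w\<close> starts at \<open>x\<^sub>1\<close>.\<close>

definition periodic_seq :: "bit list \<Rightarrow> int \<Rightarrow> bit" where
  "periodic_seq w = (\<lambda>n. w ! nat ((n - 1) mod int (length w)))"

definition cycle_of_word :: "bit list \<Rightarrow> (real \<times> real) set" where
  "cycle_of_word w = baker_orbit (coding (periodic_seq w))"

text \<open>Bi-infinite concatenations of words from \<open>W\<close>: the word number \<open>j\<close> occupies the positions
  \<open>c j, \<dots>, c (j + 1) - 1\<close>. The origin need not be a boundary between two words, so that
  the set is shift invariant.\<close>

definition bi_star :: "bit list set \<Rightarrow> (int \<Rightarrow> bit) set" where
  "bi_star W = {u. \<exists>c :: int \<Rightarrow> int. strict_mono c \<and> (\<forall>j. map u [c j..c (j + 1) - 1] \<in> W)}"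

fun thue_morse :: "nat \<Rightarrow> bit" where
  "thue_morse n = (if n = 0 then 0
     else if even n then thue_morse (n div 2) else 1 - thue_morse (n div 2))"

declare thue_morse.simps [simp del]

lemma thue_morse_0 [simp]: "thue_morse 0 = 0"
  by (subst thue_morse.simps) simp

lemma thue_morse_even [simp]: "thue_morse (2 * m) = thue_morse m"
  by (subst thue_morse.simps) simp

lemma thue_morse_odd [simp]: "thue_morse (2 * m + 1) = 1 - thue_morse m"
  by (subst thue_morse.simps) simp

text \<open>The number with binary expansion \<open>0.(t\<^sub>0 t\<^sub>1 \<dots>)\<^sup>\<infinity>\<close>, with period \<open>2 ^ k\<close>.\<close>

definition tm_number :: "nat \<Rightarrow> real" where
  "tm_number k = (\<Sum>n. digit (thue_morse (n mod 2 ^ k)) / 2 ^ (n + 1))"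

definition P :: "nat \<Rightarrow> (real \<times> real) set" where
  "P k = {(x, y). (x, y) \<in> unit_square
            \<and> 2 * x - 1 < y \<and> y < 2 * x
            \<and> 2 - 4 * x < y \<and> y < 3 - 4 * x
            \<and> tm_number k < x \<and> x < 1 - tm_number k}"

definition special_words :: "nat \<Rightarrow> bit list set" where
  "special_words n =
     {[1] @ replicate n 0,
      [0] @ replicate n 1,
      replicate n 1 @ replicate n 0,
      replicate n 0 @ [1] @ replicate n 0 @ replicate n 1 @ [0] @ replicate n 1}"

text \<open>The cycle \<open>(1\<^sup>20\<^sup>2)\<^sup>\<infinity>\<close> has the abscissae 1/5, 2/5, 3/5, 4/5, whereas \<open>closure (P k)\<close> lies
  between the abscissae \<open>tm_number k\<close> and \<open>1 - tm_number k\<close>. As \<open>tm_number k > 2/5\<close> for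
  \<open>k \<ge> 3\<close>, this cycle misses \<open>closure (P k)\<close> for these \<open>k\<close>, and a claim that all cycles
  of words in \<open>special_words n\<close> with \<open>n \<ge> 2\<close> meet \<open>closure (P k)\<close> has to except it.\<close>

lemma summable_digits: "summable (\<lambda>n. digit (f n) / 2 ^ (n + 1))"
proof (rule summable_comparison_test')
  show "summable (\<lambda>n. (1/2 :: real) ^ n)" by (simp add: summable_geometric)
  show "norm (digit (f n) / 2 ^ (n + 1)) \<le> (1/2) ^ n" if "n \<ge> 0" for n
    by (auto simp: digit_def power_one_over field_simps)
qed

lemma tm_number_gt_two_fifths:
  assumes "k \<ge> 3"
  shows "tm_number k > 2/5"
proof -
  have "(2 :: nat) ^ 3 \<le> 2 ^ k" using assms by (intro power_increasing) auto
  then have md: "n mod 2 ^ k = n" if "n < 5" for n :: nat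
    using that by simp
  have t1: "thue_morse 1 = 1" using thue_morse_odd[of 0] by simp
  have t2: "thue_morse 2 = 1" using thue_morse_even[of 1] t1 by simp
  have t3: "thue_morse 3 = 0" using thue_morse_odd[of 1] t1 by simp
  have t4: "thue_morse 4 = 1" using thue_morse_even[of 2] t2 by simp
  have "(13/32 :: real) = (\<Sum>n<5. digit (thue_morse n) / 2 ^ (n + 1))"
    using t1 t2 t3 t4 by (simp add: eval_nat_numeral digit_def)
  also have "\<dots> = (\<Sum>n<5. digit (thue_morse (n mod 2 ^ k)) / 2 ^ (n + 1))"
    using md by (intro sum.cong) auto
  also have "\<dots> \<le> tm_number k"
    unfolding tm_number_def by (intro sum_le_suminf summable_digits) (auto simp: digit_def)
  finally show ?thesis by simp
qed

lemma cycle_1100_misses_closure_P: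
  assumes "k \<ge> 3"
  shows "cycle_of_word [1, 1, 0, 0] \<inter> closure (P k) = {}"
proof -
  define f where "f = (\<lambda>n. digit (periodic_seq [1, 1, 0, 0] (int n + 1)) / 2 ^ (n + 1))"
  have per: "f (n + 4) = f n / 16" for n
  proof -
    have "(int n + 4) mod 4 = int n mod 4" by simp
    then show ?thesis by (simp add: f_def periodic_seq_def add.commute power_add)
  qed
  have "suminf f = (\<Sum>n. f (n + 4)) + (\<Sum>n<4. f n)"
    unfolding f_def by (intro suminf_split_initial_segment summable_digits)
  moreover have "(\<Sum>n. f (n + 4)) = suminf f / 16"
    unfolding per by (intro suminf_divide) (simp add: f_def summable_digits[simplified])
  moreover have "(\<Sum>n<4. f n) = 3/4"
    by (simp add: f_def periodic_seq_def digit_def eval_nat_numeral)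
  ultimately have "suminf f = 4/5" by simp
  then have start: "fst (coding (periodic_seq [1, 1, 0, 0])) = 4/5"
    by (simp add: coding_def f_def)
  have orbit: "fst ((baker ^^ j) (coding (periodic_seq [1, 1, 0, 0]))) \<in> {1/5, 2/5, 3/5, 4/5}" for j
    by (induction j) (auto simp: start baker_def split: prod.splits if_splits)
  have "closure (P k) \<subseteq> {tm_number k..1 - tm_number k} \<times> UNIV"
    by (intro closure_minimal closed_Times) (auto simp: P_def)
  then have "fst p > 2/5 \<and> fst p < 3/5" if "p \<in> closure (P k)" for p
    using that tm_number_gt_two_fifths[OF assms] by fastforce
  moreover have "\<not> (fst p > 2/5 \<and> fst p < 3/5)" if "p \<in> cycle_of_word [1, 1, 0, 0]" for p
  proof -
    have "fst p \<in> {1/5, 2/5, 3/5, 4/5}"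
      using that orbit unfolding cycle_of_word_def baker_orbit_def by blast
    then show ?thesis by auto
  qed
  ultimately show ?thesis by blast
qed

end

theory Submission
  imports Defs
begin

text \<open>Let \<open>r\<^sub>i\<close> be the lengths of the maximal constant runs of a periodic sequence. At a border between
  two runs, lying in \<open>P\<^sub>1\<close> amounts to two lexicographic comparisons of the past with the future. In the
  strip \<open>\<^bold>t\<^sub>k < x < 1 - \<^bold>t\<^sub>k\<close> these comparisons also decide membership in \<open>P\<^sub>k\<close>, and the border at the start
  of a run of length at least 3 is always in the strip. If the longest run has length \<open>n \<ge> 2\<close>
  (\<open>n \<ge> 3\<close> for \<open>k \<ge> 2\<close>), avoidance forces a run of length \<open>n\<close> to be preceded by another one, either
  directly or with a run of length 1 in between. Hence all runs have length \<open>n\<close> or 1. Moreover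
  \<open>n n n 1\<close> and \<open>n n 1 n 1\<close> cannot occur, so the run lengths are \<open>(n)\<^sup>\<infinity>\<close>, \<open>(n 1)\<^sup>\<infinity>\<close> or
  \<open>(n n 1)\<^sup>\<infinity>\<close>, first in the past and then everywhere by periodicity. These are the special words.

  Conversely, each special cycle has a symmetric border, and the point read off there lies on one
  of the edges \<open>y = 2x\<close>, \<open>y = 2 - 4x\<close> or their mirror images.\<close>

section \<open>Binary expansions and the coding of cycles\<close>

lemma bit_eq_if_both_neq: "a \<noteq> c \<Longrightarrow> b \<noteq> c \<Longrightarrow> a = b" for a b c :: bit
  by (metis bit_not_one_iff)

definition bin :: "(nat \<Rightarrow> bit) \<Rightarrow> real" where
  "bin a = (\<Sum>n. digit (a n) / 2 ^ (n + 1))"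

lemma coding_eq_bin: "coding u = (bin (\<lambda>n. u (int n + 1)), bin (\<lambda>n. u (- int n)))"
  by (simp add: coding_def bin_def)

lemma digit_simps [simp]: "digit 0 = 0" "digit 1 = 1"
  by (auto simp: digit_def)

lemma digit_bounds: "0 \<le> digit b" "digit b \<le> 1"
  by (auto simp: digit_def)

lemma digit_add_1: "digit (b + 1) = 1 - digit b"
  by (cases "b = 0") auto

lemma bin_rec: "bin a = (digit (a 0) + bin (\<lambda>n. a (Suc n))) / 2"
proof -
  have "bin a = digit (a 0) / 2 + (\<Sum>n. digit (a (Suc n)) / 2 ^ (Suc n + 1))"
    unfolding bin_def using suminf_split_head[OF summable_digits[of a]] by simp
  also have "(\<Sum>n. digit (a (Suc n)) / 2 ^ (Suc n + 1))
      = (\<Sum>n. digit (a (Suc n)) / 2 ^ (n + 1) / 2)"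
    by (simp add: field_simps)
  also have "\<dots> = bin (\<lambda>n. a (Suc n)) / 2"
    unfolding bin_def by (rule suminf_divide) (use summable_digits[of "\<lambda>n. a (Suc n)"] in simp)
  finally show ?thesis by (simp add: field_simps)
qed

lemma bin_nonneg: "0 \<le> bin a"
  unfolding bin_def by (intro suminf_nonneg summable_digits) (simp add: digit_bounds)

lemma bin_complement: "bin (\<lambda>n. a n + 1) = 1 - bin a"
proof -
  have 1: "(\<lambda>n. (1/2 :: real) ^ Suc n) sums 1"
    by (rule power_half_series)
  have 2: "(\<lambda>n. digit (a n) / 2 ^ (n + 1)) sums bin a"
    unfolding bin_def by (intro summable_sums summable_digits)
  have "(\<lambda>n. (1/2) ^ Suc n - digit (a n) / 2 ^ (n + 1)) sums (1 - bin a)"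
    by (intro sums_diff 1 2)
  also have "(\<lambda>n. (1/2) ^ Suc n - digit (a n) / 2 ^ (n + 1)) = (\<lambda>n. digit (a n + 1) / 2 ^ (n + 1))"
    by (auto simp: digit_add_1 field_simps)
  finally show ?thesis unfolding bin_def by (rule sums_unique[symmetric])
qed

lemma bin_le_1: "bin a \<le> 1"
  using bin_nonneg[of "\<lambda>n. a n + 1"] bin_complement[of a] by linarith

lemma bin_less_1: "a i = 0 \<Longrightarrow> bin a < 1"
proof (induction i arbitrary: a)
  case 0
  then show ?case using bin_rec[of a] bin_le_1[of "\<lambda>n. a (Suc n)"] by simp
next
  case (Suc i)
  then have "bin (\<lambda>n. a (Suc n)) < 1" by simp
  then show ?case using bin_rec[of a] digit_bounds(2)[of "a 0"] by simp
qed

text \<open>The zero of \<open>a\<close> beyond \<open>p\<close> excludes a tail of ones, and with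
  it the equality 0.0111... = 0.1000... that would spoil strictness.\<close>

lemma bin_less:
  assumes "\<And>i. i < p \<Longrightarrow> a i = b i" "a p = 0" "b p = 1" "p < j" "a j = 0"
  shows "bin a < bin b"
  using assms
proof (induction p arbitrary: a b j)
  case 0
  then have "bin (\<lambda>n. a (Suc n)) < 1" by (intro bin_less_1[of _ "j - 1"]) simp
  then show ?case
    using 0 bin_rec[of a] bin_rec[of b] bin_nonneg[of "\<lambda>n. b (Suc n)"] by simp
next
  case (Suc p)
  have "bin (\<lambda>n. a (Suc n)) < bin (\<lambda>n. b (Suc n))"
    by (rule Suc.IH[of _ _ "j - 1"]) (use Suc.prems in auto)
  moreover have "a 0 = b 0" using Suc.prems by simp
  ultimately show ?case using bin_rec[of a] bin_rec[of b] by simp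
qed

text \<open>Unfolding the recursion \<open>N\<close> times leaves the remainder
  \<open>X N / 2 ^ N\<close>, which vanishes because \<open>X\<close> is bounded. This identifies
  orbit coordinates with binary expansions.\<close>

lemma bin_unique:
  assumes rec: "\<And>n. X n = (digit (a n) + X (Suc n)) / 2" and bd: "\<And>n. 0 \<le> X n \<and> X n \<le> 1"
  shows "X 0 = bin a"
proof -
  have 1: "X 0 = (\<Sum>n<N. digit (a n) / 2 ^ (n + 1)) + X N / 2 ^ N" for N
  proof (induction N)
    case (Suc N)
    then show ?case by (subst (asm) rec[of N]) (simp add: field_simps)
  qed simp
  have "(\<lambda>N. X N / 2 ^ N) \<longlonglongrightarrow> 0"
  proof (rule tendsto_sandwich[of "\<lambda>_. 0" _ _ "\<lambda>N. (1/2) ^ N"])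
    show "(\<lambda>N. (1/2 :: real) ^ N) \<longlonglongrightarrow> 0" by (rule LIMSEQ_power_zero) simp
  qed (use bd in \<open>auto simp: field_simps\<close>)
  then have "(\<lambda>N. X 0 - X N / 2 ^ N) \<longlonglongrightarrow> X 0 - 0" by (intro tendsto_intros)
  moreover have "(\<lambda>N. X 0 - X N / 2 ^ N) = (\<lambda>N. \<Sum>n<N. digit (a n) / 2 ^ (n + 1))"
    using 1 by (auto simp: algebra_simps)
  ultimately have "(\<lambda>n. digit (a n) / 2 ^ (n + 1)) sums X 0" by (simp add: sums_def)
  then show ?thesis unfolding bin_def by (rule sums_unique)
qed

section \<open>Cycles as non-constant periodic sequences\<close>

lemma shift_shift [simp]: "shift i (shift j u) = shift (i + j) u"
  by (auto simp: shift_def algebra_simps)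

lemma shift_0 [simp]: "shift 0 u = u"
  by (simp add: shift_def)

lemma coding_shift:
  "coding (shift m u) = (bin (\<lambda>n. u (m + 1 + int n)), bin (\<lambda>n. u (m - int n)))"
  by (simp add: coding_eq_bin shift_def algebra_simps)

text \<open>The sequences that code cycles; the constant ones code the two excluded fixed points.
  Both digits recur in both directions, so no coordinate has an expansion with a constant
  tail.\<close>

definition periodic_mixed :: "(int \<Rightarrow> bit) \<Rightarrow> bool" where
  "periodic_mixed u \<longleftrightarrow> (\<exists>L>0. \<forall>i. u (i + L) = u i) \<and> (\<exists>i. u i = 0) \<and> (\<exists>i. u i = 1)"

lemma periodic_add_mult:
  fixes u :: "int \<Rightarrow> bit" and L :: int
  assumes "\<And>i. u (i + L) = u i"
  shows "u (i + k * L) = u i"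
proof (induction k arbitrary: i rule: int_induct[of _ 0])
  case (step1 k)
  then show ?case using assms[of "i + k * L"] by (simp add: algebra_simps)
next
  case (step2 k)
  then show ?case using assms[of "i + (k - 1) * L"] by (simp add: algebra_simps)
qed simp

lemma periodic_mixed_occurs:
  assumes "periodic_mixed u"
  shows "\<exists>i>m. u i = b" "\<exists>i<m. u i = b"
proof -
  obtain L where L: "L > 0" "\<And>i. u (i + L) = u i"
    using assms by (auto simp: periodic_mixed_def)
  obtain i where i: "u i = b"
    using assms unfolding periodic_mixed_def by (metis bit_not_one_iff)
  define k where "k = \<bar>m\<bar> + \<bar>i\<bar> + 1"
  have "k * L \<ge> k * 1" using L by (intro mult_left_mono) (auto simp: k_def)
  then have "k * L \<ge> \<bar>m\<bar> + \<bar>i\<bar> + 1" unfolding k_def by simp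
  moreover have "(- k) * L = - (k * L)" by simp
  ultimately have "i + k * L > m" "i + (- k) * L < m" by linarith+
  then show "\<exists>i>m. u i = b" "\<exists>i<m. u i = b"
    using periodic_add_mult[of u L, OF L(2)] i by blast+
qed

lemma periodic_mixed_shift:
  assumes "periodic_mixed u"
  shows "periodic_mixed (shift m u)"
proof -
  obtain L where L: "L > 0" "\<And>i. u (i + L) = u i"
    using assms by (auto simp: periodic_mixed_def)
  then have "shift m u (i + L) = shift m u i" for i
    using L(2)[of "i + m"] by (simp add: shift_def algebra_simps)
  moreover have "\<exists>i. shift m u i = b" for b
    using periodic_mixed_occurs(1)[OF assms, of 0 b] unfolding shift_def by (metis diff_add_cancel)
  ultimately show ?thesis unfolding periodic_mixed_def using L(1) by blast
qed

lemma periodic_mixed_complement: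
  assumes "periodic_mixed u"
  shows "periodic_mixed (\<lambda>i. u i + 1)"
  using assms unfolding periodic_mixed_def by (auto; metis)

lemma baker_coding:
  assumes "periodic_mixed u"
  shows "baker (coding (shift m u)) = coding (shift (m + 1) u)"
proof -
  let ?X = "bin (\<lambda>n. u (m + 1 + int n))" and ?X' = "bin (\<lambda>n. u (m + 2 + int n))"
  let ?Y = "bin (\<lambda>n. u (m - int n))" and ?Y' = "bin (\<lambda>n. u (m + 1 - int n))"
  have "(\<lambda>n. u (m + 1 + int (Suc n))) = (\<lambda>n. u (m + 2 + int n))"
    "(\<lambda>n. u (m + 1 - int (Suc n))) = (\<lambda>n. u (m - int n))"
    by (simp_all add: algebra_simps)
  then have rec: "?X = (digit (u (m + 1)) + ?X') / 2" "?Y' = (digit (u (m + 1)) + ?Y) / 2"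
    using bin_rec[of "\<lambda>n. u (m + 1 + int n)"] bin_rec[of "\<lambda>n. u (m + 1 - int n)"] by simp_all
  \<comment> \<open>A later 0 keeps \<open>?X'\<close> below 1, so the leading digit of
    \<open>?X\<close> decides on which side of 1/2 it lies, and thereby the branch of
    \<open>baker\<close>.\<close>
  obtain j where "j > m + 2" "u j = 0" using periodic_mixed_occurs(1)[OF assms] by blast
  then have "?X' < 1" by (intro bin_less_1[of _ "nat (j - (m + 2))"]) simp
  moreover have "?X' \<ge> 0" by (rule bin_nonneg)
  moreover have "coding (shift m u) = (?X, ?Y)" "coding (shift (m + 1) u) = (?X', ?Y')"
    by (simp_all add: coding_shift algebra_simps)
  ultimately show ?thesis using rec by (cases "u (m + 1) = 0") (auto simp: baker_def field_simps)
qed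

lemma baker_orbit_coding:
  assumes "periodic_mixed u"
  shows "baker_orbit (coding u) = range (\<lambda>m. coding (shift m u))"
proof -
  have pow: "(baker ^^ k) (coding u) = coding (shift (int k) u)" for k
    by (induction k) (simp_all add: baker_coding[OF assms] algebra_simps)
  obtain L where L: "L > 0" "\<And>i. u (i + L) = u i"
    using assms by (auto simp: periodic_mixed_def)
  have "coding (shift m u) \<in> range (\<lambda>k. coding (shift (int k) u))" for m
  proof -
    \<comment> \<open>Adding \<open>\<bar>m\<bar>\<close> periods turns a negative shift into a
      forward iterate.\<close>
    have "m + \<bar>m\<bar> * L \<ge> m + \<bar>m\<bar> * 1" using L by (intro add_left_mono mult_left_mono) auto
    then have "m + \<bar>m\<bar> * L \<ge> 0" by simp
    moreover have "shift (m + \<bar>m\<bar> * L) u = shift m u"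
      using periodic_add_mult[of u L, OF L(2)] by (auto simp: shift_def add.assoc[symmetric])
    ultimately show ?thesis by (metis nat_0_le rangeI)
  qed
  then show ?thesis unfolding baker_orbit_def pow by blast
qed

lemma baker_in_unit_square: "p \<in> unit_square \<Longrightarrow> baker p \<in> unit_square"
  by (auto simp: unit_square_def baker_def)

text \<open>Symbolic itinerary: a digit records the half of the square that is visited. By
  \<open>bin_unique\<close>, x is then the expansion of the future digits and y that of the past
  ones.\<close>

lemma cycle_coding:
  assumes "is_cycle C"
  obtains u where "periodic_mixed u" "C = range (\<lambda>m. coding (shift m u))"
proof -
  obtain p N where p: "p \<in> unit_square" "N \<ge> 1" "(baker ^^ N) p = p" "C = baker_orbit p"
    and nfix: "C \<noteq> {(0, 0)}" "C \<noteq> {(1, 1)}"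
    using assms unfolding is_cycle_def by blast
  \<comment> \<open>Reducing the index modulo the period extends the forward orbit to all of
    \<open>int\<close>.\<close>
  define q where "q i = (baker ^^ nat (i mod int N)) p" for i :: int
  \<comment> \<open>The half containing \<open>q 0\<close> gives the digit at position 1, hence
    \<open>i - 1\<close>.\<close>
  define u where "u i = (if fst (q (i - 1)) < 1/2 then 0 else 1 :: bit)" for i
  have sq: "q i \<in> unit_square" for i
  proof -
    have "(baker ^^ k) p \<in> unit_square" for k
      by (induction k) (auto simp: p(1) baker_in_unit_square)
    then show ?thesis by (simp add: q_def)
  qed
  have qS: "q (i + 1) = baker (q i)" for i
  proof -
    have "int ((nat (i mod int N) + 1) mod N) = (i + 1) mod int N"
      using p(2) by (simp add: zmod_int mod_add_right_eq add.commute)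
    then have "nat ((i + 1) mod int N) = Suc (nat (i mod int N)) mod N"
      by (metis Suc_eq_plus1 nat_int)
    then show ?thesis unfolding q_def by (simp add: funpow_mod_eq[OF p(3)])
  qed
  have recX: "fst (q i) = (digit (u (i + 1)) + fst (q (i + 1))) / 2"
    and recY: "snd (q (i + 1)) = (digit (u (i + 1)) + snd (q i)) / 2" for i
    unfolding qS u_def by (auto simp: baker_def split: prod.splits)
  have bd: "0 \<le> fst (q i) \<and> fst (q i) \<le> 1" "0 \<le> snd (q i) \<and> snd (q i) \<le> 1" for i
    using sq[of i] by (auto simp: unit_square_def mem_Times_iff)
  have qc: "q m = coding (shift m u)" for m
  proof -
    have "fst (q (m + int 0)) = bin (\<lambda>n. u (m + 1 + int n))"
      by (rule bin_unique[of "\<lambda>n. fst (q (m + int n))"])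
        (use recX[of "m + int _"] bd in \<open>auto simp: algebra_simps\<close>)
    moreover have "snd (q (m - int 0)) = bin (\<lambda>n. u (m - int n))"
      by (rule bin_unique[of "\<lambda>n. snd (q (m - int n))"])
        (use recY[of "m - int _ - 1"] bd in \<open>auto simp: algebra_simps\<close>)
    ultimately show ?thesis by (simp add: coding_shift prod_eq_iff)
  qed
  have C: "C = range (\<lambda>m. coding (shift m u))"
  proof -
    have pk: "(baker ^^ k) p = q (int k)" for k
      by (simp add: q_def zmod_int[symmetric] funpow_mod_eq[OF p(3)])
    then have "C \<subseteq> range q" unfolding p(4) baker_orbit_def by auto
    moreover have "range q \<subseteq> C" unfolding p(4) baker_orbit_def q_def by auto
    ultimately show ?thesis using qc by auto
  qed
  have "u (i + int N) = u i" for i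
    unfolding u_def q_def by (simp add: diff_add_eq[symmetric])
  moreover have "\<exists>i. u i = 1"
  proof (rule ccontr)
    assume "\<nexists>i. u i = 1"
    then have "u = (\<lambda>_. 0)" by auto
    then have "C = {(0, 0)}" unfolding C by (auto simp: coding_shift bin_def)
    then show False using nfix by simp
  qed
  moreover have "\<exists>i. u i = 0"
  proof (rule ccontr)
    assume "\<nexists>i. u i = 0"
    then have "u = (\<lambda>_. 1)" by auto
    moreover have "bin (\<lambda>_. 1) = 1"
      using bin_complement[of "\<lambda>_. 0"] by (simp add: bin_def)
    ultimately have "C = {(1, 1)}" unfolding C by (auto simp: coding_shift)
    then show False using nfix by simp
  qed
  ultimately have "periodic_mixed u"
    unfolding periodic_mixed_def using p(2) by (metis of_nat_0_less_iff less_eq_Suc_le One_nat_def)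
  then show ?thesis using C that by blast
qed

section \<open>Sequences with extremal runs\<close>

text \<open>The assumption \<open>avoid\<close> is the combinatorial form of missing the polygon at the border
  between \<open>s\<close> and \<open>s + 1\<close>. Write \<open>y = 0.x\<^sub>0x\<^sub>-\<^sub>1\<dots>\<close> and \<open>x = 0.01z\<close> if \<open>u s = 0\<close>, with
  \<open>x\<^sub>1 = u s\<close>. Then \<open>p\<close> is the first position at which \<open>y\<close> and \<open>1z\<close> differ and witnesses
  \<open>y < 2x\<close>, while \<open>q\<close> is the first position at which \<open>1 - y\<close> and \<open>z\<close> differ and witnesses
  \<open>y > 2 - 4x\<close>. For \<open>u s = 1\<close> all digits are complemented.\<close>

locale extremal_runs =
  fixes u :: "int \<Rightarrow> bit" and n :: int
  assumes n2: "2 \<le> n"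
    and no_longer: "\<And>s. \<exists>i. 1 \<le> i \<and> i \<le> n \<and> u (s - i) \<noteq> u s"
    and avoid: "\<And>s p q. \<lbrakk>\<forall>i. 1 \<le> i \<and> i \<le> n \<longrightarrow> u (s + i) \<noteq> u s; 0 \<le> p; 0 \<le> q;
        \<forall>i. 0 \<le> i \<and> i < p \<longrightarrow> u (s - 1 - i) = u (s + 1 + i);
        u (s - 1 - p) = u s; u (s + 1 + p) \<noteq> u s;
        \<forall>i. 0 \<le> i \<and> i < q \<longrightarrow> u (s - 1 - i) \<noteq> u (s + 2 + i);
        u (s - 1 - q) \<noteq> u s; u (s + 2 + q) \<noteq> u s\<rbrakk> \<Longrightarrow> False"
begin

text \<open>The block occupies \<open>s + 1\<close> to \<open>s + n\<close>, and both neighbours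
  carry the other digit, so it is a maximal run. The index \<open>s\<close> just before it is the
  border position used in \<open>avoid\<close>.\<close>

definition run :: "int \<Rightarrow> bool" where
  "run s \<longleftrightarrow> u (s + n + 1) = u s \<and> (\<forall>i. 1 \<le> i \<and> i \<le> n \<longrightarrow> u (s + i) \<noteq> u s)"

lemma run_next: "run s \<Longrightarrow> u (s + n + 1) = u s"
  by (simp add: run_def)

lemma run_neq:
  assumes "run s" "s < t" "t \<le> s + n"
  shows "u t \<noteq> u s"
proof -
  have "1 \<le> t - s \<and> t - s \<le> n \<longrightarrow> u (s + (t - s)) \<noteq> u s"
    using assms(1) unfolding run_def by blast
  then show ?thesis using assms(2,3) by simp
qed

lemma first_change:
  obtains j where "1 \<le> j" "j \<le> n" "u (s - j) \<noteq> u s" "\<And>i. 0 \<le> i \<Longrightarrow> i < j \<Longrightarrow> u (s - i) = u s"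
proof -
  obtain i where i: "1 \<le> i" "i \<le> n" "u (s - i) \<noteq> u s" using no_longer by blast
  define k where "k = (LEAST k::nat. u (s - int k) \<noteq> u s)"
  have ex: "u (s - int (nat i)) \<noteq> u s" using i by simp
  have 1: "u (s - int k) \<noteq> u s" unfolding k_def by (rule LeastI[of _ "nat i"]) (rule ex)
  have 2: "k \<le> nat i" unfolding k_def by (rule Least_le) (rule ex)
  have 3: "u (s - int m) = u s" if "m < k" for m
    using not_less_Least[OF that[unfolded k_def]] by simp
  have "k \<noteq> 0" using 1 by (intro notI) simp
  show ?thesis
  proof (rule that[of "int k"])
    show "u (s - i) = u s" if "0 \<le> i" "i < int k" for i
      using 3[of "nat i"] that by simp
  qed (use 1 2 i \<open>k \<noteq> 0\<close> in auto)
qed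

text \<open>Let \<open>j\<close> be the length of the run ending at \<open>s\<close> or, if that run
  is the single digit at \<open>s\<close>, of the run before it. If \<open>j < n\<close>, the run
  starting at \<open>s + 1\<close> outlasts it, and \<open>avoid\<close> applies with
  \<open>p = 0\<close>, \<open>q = j - 1\<close> or with \<open>p = j\<close>,
  \<open>q = 0\<close>.\<close>

lemma run_prev:
  assumes r: "run s"
  shows "run (s - n) \<or> run (s - n - 1)"
proof (cases "u (s - 1) = u s")
  case True
  obtain j where j: "1 \<le> j" "j \<le> n" "u (s - j) \<noteq> u s"
    "\<And>i. 0 \<le> i \<Longrightarrow> i < j \<Longrightarrow> u (s - i) = u s"
    using first_change[of s] by blast
  have "j \<noteq> 1" using True j by auto
  have "j = n"
  proof (rule ccontr)
    assume "j \<noteq> n"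
    show False
    proof (rule avoid[of s 0 "j - 1"])
      show "\<forall>i. 0 \<le> i \<and> i < j - 1 \<longrightarrow> u (s - 1 - i) \<noteq> u (s + 2 + i)"
      proof (intro allI impI)
        fix i assume "0 \<le> i \<and> i < j - 1"
        then show "u (s - 1 - i) \<noteq> u (s + 2 + i)"
          using j(4)[of "1 + i"] run_neq[OF r, of "s + 2 + i"] j by (simp add: diff_diff_eq)
      qed
    qed (use r True j \<open>j \<noteq> 1\<close> \<open>j \<noteq> n\<close> run_neq[OF r] in \<open>auto simp: run_def\<close>)
  qed
  have "u (s - n + i) \<noteq> u (s - n)" if "1 \<le> i" "i \<le> n" for i
    using j(3) j(4)[of "n - i"] that \<open>j = n\<close> by (simp add: algebra_simps)
  moreover have "u (s + 1) = u (s - n)"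
    using run_neq[OF r, of "s + 1"] n2 j(3) \<open>j = n\<close> by (intro bit_eq_if_both_neq[of _ "u s"]) auto
  ultimately show ?thesis by (simp add: run_def)
next
  case False
  obtain j where j: "1 \<le> j" "j \<le> n" "u (s - 1 - j) \<noteq> u (s - 1)"
    "\<And>i. 0 \<le> i \<Longrightarrow> i < j \<Longrightarrow> u (s - 1 - i) = u (s - 1)"
    using first_change[of "s - 1"] by blast
  have us: "u (s - 1 - j) = u s" by (rule bit_eq_if_both_neq[OF j(3)]) (use False in simp)
  have "j = n"
  proof (rule ccontr)
    assume "j \<noteq> n"
    show False
    proof (rule avoid[of s j 0])
      show "\<forall>i. 0 \<le> i \<and> i < j \<longrightarrow> u (s - 1 - i) = u (s + 1 + i)"
      proof (intro allI impI)
        fix i assume i: "0 \<le> i \<and> i < j"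
        show "u (s - 1 - i) = u (s + 1 + i)"
          by (rule bit_eq_if_both_neq[of _ "u s"])
            (use i j(2) j(4)[of i] False run_neq[OF r, of "s + 1 + i"] in auto)
      qed
    qed (use r False us j \<open>j \<noteq> n\<close> run_neq[OF r] n2 in \<open>auto simp: run_def\<close>)
  qed
  have "u (s - n - 1 + i) \<noteq> u (s - n - 1)" if "1 \<le> i" "i \<le> n" for i
    using j(3) j(4)[of "n - i"] that \<open>j = n\<close> by (simp add: algebra_simps)
  moreover have "u s = u (s - n - 1)"
    using us \<open>j = n\<close> by (simp add: algebra_simps)
  ultimately show ?thesis by (simp add: run_def)
qed

lemma run_F: "run s \<Longrightarrow> run (s - n) \<Longrightarrow> u s \<noteq> u (s - n)"
  using run_neq[of "s - n" s] n2 by simp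

lemma run_T: "run s \<Longrightarrow> run (s - n - 1) \<Longrightarrow> u s = u (s - n - 1)"
  using run_next[of "s - n - 1"] by simp

text \<open>The border lies between the second and the third of three adjacent blocks. The
  complemented past matches the future from \<open>s + 2\<close> up to the single digit at
  \<open>s + n + 1\<close>, which gives \<open>q = n\<close>; \<open>p\<close> is 0 since
  \<open>u (s - 1) = u s\<close>.\<close>

lemma no_nnn1:
  assumes r: "run s" "run (s - n)" "run (s - 2 * n)" "run (s + n + 1)"
  shows False
proof (rule avoid[of s 0 n])
  have a: "u (s - 1 - i) = u s" if "0 \<le> i" "i < n - 1" for i
    by (rule bit_eq_if_both_neq[of _ "u (s - n)"])
      (use that run_neq[OF r(2), of "s - 1 - i"] run_neq[OF r(2), of s] in auto)
  have b: "u (s - n) \<noteq> u s" using run_neq[OF r(2), of s] n2 by auto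
  have c: "u (s - 1 - n) = u (s - n)"
    by (rule bit_eq_if_both_neq[of _ "u (s - 2 * n)"])
      (use n2 run_neq[OF r(3), of "s - 1 - n"] run_neq[OF r(3), of "s - n"] in auto)
  show "u (s - 1 - n) \<noteq> u s" using b c by simp
  show "u (s + 2 + n) \<noteq> u s"
    using run_neq[OF r(4), of "s + 2 + n"] run_next[OF r(1)] n2 by auto
  show "\<forall>i. 0 \<le> i \<and> i < n \<longrightarrow> u (s - 1 - i) \<noteq> u (s + 2 + i)"
  proof (intro allI impI)
    fix i assume i: "0 \<le> i \<and> i < n"
    show "u (s - 1 - i) \<noteq> u (s + 2 + i)"
    proof (cases "i = n - 1")
      case True
      then have "s - 1 - i = s - n" "s + 2 + i = s + n + 1" by simp_all
      then show ?thesis using b run_next[OF r(1)] by presburger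
    next
      case False
      then show ?thesis using i a[of i] run_neq[OF r(1), of "s + 2 + i"] by auto
    qed
  qed
  show "u (s - 1 - 0) = u s" using a[of 0] n2 by simp
qed (use r n2 run_neq[OF r(1)] in \<open>auto simp: run_def\<close>)

text \<open>The border follows the first single digit, at \<open>s\<close>. Past and future of
  \<open>s\<close> agree on a block and on the digit after it. In the past this digit begins a block
  of length \<open>n \<ge> 2\<close>, in the future it is single, so \<open>p = n + 1\<close>; and
  \<open>q = 0\<close>.\<close>

lemma no_nn1n1:
  assumes r: "run s" "run (s - n - 1)" "run (s - 2 * n - 1)" "run (s + n + 1)"
  shows False
proof (rule avoid[of s "n + 1" 0])
  have b: "u (s - n - 1) = u s" using run_next[OF r(2)] by simp
  have a: "u (s - 1 - i) \<noteq> u s" if "0 \<le> i" "i < n" for i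
    using that run_neq[OF r(2), of "s - 1 - i"] b by auto
  have c: "u (s - n - 2) = u (s - n - 1)"
    by (rule bit_eq_if_both_neq[of _ "u (s - 2 * n - 1)"])
      (use n2 run_neq[OF r(3), of "s - n - 2"] run_neq[OF r(3), of "s - n - 1"] in auto)
  show "u (s - 1 - (n + 1)) = u s" using b c by (simp add: algebra_simps)
  show "u (s + 1 + (n + 1)) \<noteq> u s"
    using run_neq[OF r(4), of "s + n + 2"] run_next[OF r(1)] n2 by (auto simp: algebra_simps)
  show "\<forall>i. 0 \<le> i \<and> i < n + 1 \<longrightarrow> u (s - 1 - i) = u (s + 1 + i)"
  proof (intro allI impI)
    fix i assume i: "0 \<le> i \<and> i < n + 1"
    show "u (s - 1 - i) = u (s + 1 + i)"
    proof (cases "i = n")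
      case True
      then show ?thesis using b run_next[OF r(1)] by (simp add: algebra_simps)
    next
      case False
      show ?thesis
        by (rule bit_eq_if_both_neq[of _ "u s"])
          (use False i a[of i] run_neq[OF r(1), of "s + 1 + i"] in auto)
    qed
  qed
  show "u (s - 1 - 0) \<noteq> u s" using a[of 0] n2 by simp
qed (use r n2 run_neq[OF r(1)] in \<open>auto simp: run_def\<close>)

text \<open>Read backwards, the longest runs follow each other directly (F) or with one single digit in
  between (T). The two preceding lemmas forbid the patterns TFF and TTF, so the pattern is
  eventually constant or alternating.\<close>

lemma backward_runs:
  assumes "run s0"
  obtains s where "\<And>j. run (s - int j * n)"
  | s where "\<And>j. run (s - int j * (n + 1))"
  | s where "\<And>j. run (s - int j * (2 * n + 1))" "\<And>j. run (s - int j * (2 * n + 1) - n - 1)"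
proof -
  obtain f where f: "\<And>k. run (f k)" "\<And>k. f (Suc k) = f k - n \<or> f (Suc k) = f k - n - 1"
  proof -
    have "\<exists>f. \<forall>k. run (f k) \<and> (f (Suc k) = f k - n \<or> f (Suc k) = f k - n - 1)"
      by (rule dependent_nat_choice) (use assms run_prev in blast)+
    then show ?thesis using that by blast
  qed
  \<comment> \<open>\<open>E k\<close> says that step \<open>k\<close> has type T.\<close>
  define E where "E k \<longleftrightarrow> f (Suc k) = f k - n - 1" for k
  have fT: "f (Suc k) = f k - n - 1" if "E k" for k using that by (simp add: E_def)
  have fF: "f (Suc k) = f k - n" if "\<not> E k" for k using that f(2)[of k] by (simp add: E_def)
  have TFT: "E (Suc (Suc k))" if "E k" "\<not> E (Suc k)" for k
  proof (rule ccontr)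
    assume "\<not> E (Suc (Suc k))"
    then show False
      using no_nnn1[of "f (Suc k)"] f(1)[of k] f(1)[of "Suc k"] f(1)[of "Suc (Suc k)"]
        f(1)[of "Suc (Suc (Suc k))"] fT[OF that(1)] fF[OF that(2)] fF[of "Suc (Suc k)"]
      by (simp add: algebra_simps)
  qed
  have TTT: "E (Suc (Suc k))" if "E k" "E (Suc k)" for k
  proof (rule ccontr)
    assume "\<not> E (Suc (Suc k))"
    then show False
      using no_nn1n1[of "f (Suc k)"] f(1)[of k] f(1)[of "Suc k"] f(1)[of "Suc (Suc k)"]
        f(1)[of "Suc (Suc (Suc k))"] fT[OF that(1)] fT[OF that(2)] fF[of "Suc (Suc k)"]
      by (simp add: algebra_simps)
  qed
  \<comment> \<open>\<open>TTT\<close> makes two adjacent T persist. If no two are adjacent,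
    \<open>TFT\<close> forces strict alternation from any T on.\<close>
  consider (F) "\<And>k. \<not> E k" | (T) K where "E K" "E (Suc K)"
    | (A) K where "E K" "\<And>k. \<not> (E k \<and> E (Suc k))" by blast
  then show ?thesis
  proof cases
    case F
    have fk: "f k = f 0 - int k * n" for k
    proof (induction k)
      case (Suc k)
      have "f (Suc k) = f k - n" using F by (rule fF)
      with Suc show ?case by (simp add: algebra_simps)
    qed simp
    have "run (f 0 - int k * n)" for k using f(1)[of k] unfolding fk[of k] .
    then show ?thesis by (rule that(1))
  next
    case T
    have EE: "E (K + k) \<and> E (Suc (K + k))" for k
    proof (induction k)
      case 0
      show ?case using T by simp
    next
      case (Suc k)
      then show ?case using TTT[of "K + k"] by simp
    qed
    have fk: "f (K + k) = f K - int k * (n + 1)" for k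
    proof (induction k)
      case (Suc k)
      have "f (Suc (K + k)) = f (K + k) - n - 1" using EE by (intro fT) simp
      with Suc show ?case by (simp add: algebra_simps)
    qed simp
    have "run (f K - int k * (n + 1))" for k using f(1)[of "K + k"] unfolding fk[of k] .
    then show ?thesis by (rule that(2))
  next
    case A
    have EE: "E (K + 2 * k)" for k
    proof (induction k)
      case 0
      show ?case using A(1) by simp
    next
      case (Suc k)
      then show ?case using TFT[of "K + 2 * k"] A(2)[of "K + 2 * k"] by simp
    qed
    have NE: "\<not> E (Suc (K + 2 * k))" for k using A(2)[of "K + 2 * k"] EE[of k] by blast
    have 1: "f (Suc (K + 2 * k)) = f (K + 2 * k) - n - 1" for k
      using fT[OF EE] .
    have 2: "f (K + 2 * k) = f K - int k * (2 * n + 1)" for k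
    proof (induction k)
      case (Suc k)
      have "f (K + 2 * Suc k) = f (Suc (K + 2 * k)) - n" using fF[OF NE[of k]] by simp
      with Suc 1[of k] show ?case by (simp add: algebra_simps)
    qed simp
    have "run (f K - int k * (2 * n + 1))" "run (f K - int k * (2 * n + 1) - n - 1)" for k
      using f(1)[of "K + 2 * k"] f(1)[of "Suc (K + 2 * k)"] 1[of k] 2[of k] by simp_all
    then show ?thesis by (rule that(3))
  qed
qed

end

section \<open>From blocks in the past to the whole sequence\<close>

lemma periodic_from_blocks:
  assumes per: "\<And>i. u (i + L) = u i" "(L :: int) > 0" and w: "w \<noteq> []"
    and blocks: "\<And>j k. k < length w \<Longrightarrow> u (p - int j * int (length w) + int k) = w ! k"
  shows "u (p + i) = (w ! nat (i mod int (length w)) :: bit)"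
proof -
  define l where "l = int (length w)"
  define q where "q = i div l"
  have l: "l > 0" using w by (simp add: l_def)
  \<comment> \<open>The blocks are known only from \<open>p\<close> leftwards. Going back
    \<open>\<bar>q\<bar> * l\<close> periods moves by a whole number of words and lands among them,
    because \<open>\<bar>q\<bar> * L - q \<ge> 0\<close>.\<close>
  have "\<bar>q\<bar> * L \<ge> \<bar>q\<bar> * 1" using per(2) by (intro mult_left_mono) auto
  then have j: "int (nat (\<bar>q\<bar> * L - q)) = \<bar>q\<bar> * L - q" by simp
  have r: "0 \<le> i mod l" "i mod l < l" using l by auto
  have "u (p + i) = u (p + i + (- \<bar>q\<bar> * l) * L)"
    using periodic_add_mult[of u L, OF per(1)] by metis
  also have "i = q * l + i mod l" by (simp add: q_def)
  then have "p + i + (- \<bar>q\<bar> * l) * L = p - (\<bar>q\<bar> * L - q) * l + i mod l"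
    by (simp add: algebra_simps)
  also have "u \<dots> = w ! nat (i mod l)"
    using blocks[of "nat (i mod l)" "nat (\<bar>q\<bar> * L - q)"] r unfolding j by (simp add: l_def)
  finally show ?thesis by (simp add: l_def)
qed

lemma cycle_of_word_eq:
  assumes u: "periodic_mixed u" and w: "\<And>i. u (p + i) = w ! nat (i mod int (length w))"
  shows "cycle_of_word w = range (\<lambda>m. coding (shift m u))"
proof -
  \<comment> \<open>The word starts at position 1 of \<open>periodic_seq w\<close> but at
    \<open>p\<close> in \<open>u\<close>.\<close>
  have "periodic_seq w = shift (p - 1) u"
  proof
    fix i
    show "periodic_seq w i = shift (p - 1) u i"
      using w[of "i - 1"] by (simp add: periodic_seq_def shift_def algebra_simps)
  qed
  then have "cycle_of_word w = range (\<lambda>m. coding (shift (m + (p - 1)) u))"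
    using baker_orbit_coding[OF periodic_mixed_shift[OF u, of "p - 1"]]
    by (simp add: cycle_of_word_def)
  also have "\<dots> = range (\<lambda>m. coding (shift m u))"
  proof -
    have "coding (shift m u) \<in> range (\<lambda>m. coding (shift (m + (p - 1)) u))" for m
      by (rule range_eqI[of _ _ "m - (p - 1)"]) simp
    then show ?thesis by auto
  qed
  finally show ?thesis .
qed

context extremal_runs
begin

text \<open>The spacing of the runs fixes every digit far back: the digits before the blocks
  alternate for spacing \<open>n\<close>, are constant for \<open>n + 1\<close>, and alternate from
  one \<open>2 * n + 1\<close> to the next in the third case. The words are 1^n0^n, then 10^n or
  01^n, then 0^n10^n1^n01^n; \<open>periodic_from_blocks\<close> extends them to all
  positions.\<close>

lemma special_word_exists:
  assumes per: "\<And>i. u (i + L) = u i" "L > 0" and "run s0"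
  shows "\<exists>w\<in>special_words (nat n). \<exists>p. \<forall>i. u (p + i) = w ! nat (i mod int (length w))"
proof -
  define N where "N = nat n"
  have N: "int N = n" "N \<ge> 2" using n2 by (auto simp: N_def)
  have bit_flip: "a \<noteq> b \<Longrightarrow> a = 0 \<Longrightarrow> b = 1" "a \<noteq> b \<Longrightarrow> a = 1 \<Longrightarrow> b = 0" for a b :: bit by auto
  have *: ?thesis if "w \<in> special_words N" "w \<noteq> []"
    "\<And>j k. k < length w \<Longrightarrow> u (p - int j * int (length w) + int k) = w ! k" for w p
    using periodic_from_blocks[of u L w p, OF per that(2,3)] that(1) unfolding N_def by blast
  from \<open>run s0\<close> show ?thesis
  proof (cases rule: backward_runs)
    case (1 s')
    have alt: "u (s' - int (Suc j) * n) \<noteq> u (s' - int j * n)" for j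
      using run_F[of "s' - int j * n"] 1[of j] 1[of "Suc j"] by (simp add: algebra_simps)
    \<comment> \<open>Starting one block earlier if necessary fixes the phase of the word.\<close>
    obtain s where s: "\<And>j. run (s - int j * n)" "u s = 0"
    proof (cases "u s' = 0")
      case False
      then have "u (s' - n) = 0" using alt[of 0] by auto
      moreover have "run (s' - n - int j * n)" for j
        using 1[of "Suc j"] by (simp add: algebra_simps)
      ultimately show ?thesis using that by blast
    qed (use 1 that in blast)
    have alt: "u (s - int (Suc j) * n) \<noteq> u (s - int j * n)" for j
      using run_F[of "s - int j * n"] s(1)[of j] s(1)[of "Suc j"] by (simp add: algebra_simps)
    have col: "u (s - int (2 * j) * n) = 0 \<and> u (s - int (Suc (2 * j)) * n) = 1" for j
    proof (induction j)
      case 0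
      show ?case using s(2) alt[of 0] by auto
    next
      case (Suc j)
      have "u (s - int (2 * Suc j) * n) = 0"
        using bit_flip(2)[OF alt[of "Suc (2 * j)", symmetric]] Suc by simp
      then show ?case using alt[of "2 * Suc j"] by auto
    qed
    let ?w = "replicate N 1 @ replicate N 0 :: bit list"
    show ?thesis
    proof (rule *[of ?w "s - 2 * n + 1"])
      fix j k
      assume k: "k < length ?w"
      let ?t = "s - 2 * n + 1 - int j * int (length ?w) + int k"
      let ?b = "s - int (2 * Suc j) * n" and ?b' = "s - int (Suc (2 * j)) * n"
      have t: "?t = ?b + int k + 1" "?t = ?b' + int k + 1 - n"
        using N(1) by (simp_all add: algebra_simps)
      show "u ?t = ?w ! k"
      proof (cases "k < N")
        case True
        have "u ?t \<noteq> u ?b" by (rule run_neq[OF s(1)]) (use True N t in auto)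
        then show ?thesis using True col[of "Suc j"] by (simp add: nth_append)
      next
        case False
        have "u ?t \<noteq> u ?b'" by (rule run_neq[OF s(1)]) (use False k N t in auto)
        then show ?thesis using False k col[of j] by (simp add: nth_append)
      qed
    qed (use N in \<open>auto simp: special_words_def\<close>)
  next
    case (2 s)
    have col: "u (s - int j * (n + 1)) = u s" for j
    proof (induction j)
      case (Suc j)
      have "u (s - int j * (n + 1)) = u (s - int j * (n + 1) - n - 1)"
        by (rule run_T) (use 2[of j] 2[of "Suc j"] in \<open>simp_all add: algebra_simps\<close>)
      with Suc show ?case by (simp add: algebra_simps)
    qed simp
    let ?w = "[u s] @ replicate N (u s + 1)"
    show ?thesis
    proof (rule *[of ?w s])
      have "u s = 0 \<or> u s = 1" by auto
      then show "?w \<in> special_words N" by (auto simp: special_words_def)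
      fix j k
      assume k: "k < length ?w"
      have len: "int (length ?w) = n + 1" using N by simp
      show "u (s - int j * int (length ?w) + int k) = ?w ! k"
      proof (cases "k = 0")
        case True
        then show ?thesis unfolding len using col[of j] by simp
      next
        case False
        have "u (s - int j * (n + 1) + int k) \<noteq> u (s - int j * (n + 1))"
          by (rule run_neq[OF 2]) (use False k N in auto)
        then have "u (s - int j * (n + 1) + int k) = u s + 1" unfolding col by auto
        then show ?thesis unfolding len using False k by (simp add: nth_Cons')
      qed
    qed simp
  next
    case (3 s')
    let ?M = "2 * n + 1"
    have alt: "u (s' - int (Suc j) * ?M) \<noteq> u (s' - int j * ?M)" for j
    proof -
      have "u (s' - int j * ?M) = u (s' - int j * ?M - n - 1)"
        by (rule run_T) (use 3[of j] in auto)
      also have "\<dots> \<noteq> u (s' - int (Suc j) * ?M)"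
        by (rule run_neq[OF 3(1)]) (use n2 in \<open>auto simp: algebra_simps\<close>)
      finally show ?thesis by simp
    qed
    obtain s where s: "\<And>j. run (s - int j * ?M)" "\<And>j. run (s - int j * ?M - n - 1)" "u s = 0"
    proof (cases "u s' = 0")
      case False
      then have "u (s' - ?M) = 0" using alt[of 0] by auto
      moreover have "run (s' - ?M - int j * ?M)" "run (s' - ?M - int j * ?M - n - 1)" for j
        using 3[of "Suc j"] by (simp_all add: algebra_simps)
      ultimately show ?thesis using that by blast
    qed (use 3 that in blast)
    have mid: "u (s - int j * ?M) = u (s - int j * ?M - n - 1)" for j
      by (rule run_T) (use s in auto)
    have alt: "u (s - int (Suc j) * ?M) \<noteq> u (s - int j * ?M)" for j
    proof -
      have "u (s - int j * ?M - n - 1) \<noteq> u (s - int (Suc j) * ?M)"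
        by (rule run_neq[OF s(1)]) (use n2 in \<open>auto simp: algebra_simps\<close>)
      then show ?thesis using mid by simp
    qed
    have col: "u (s - int (2 * j) * ?M) = 0 \<and> u (s - int (Suc (2 * j)) * ?M) = 1" for j
    proof (induction j)
      case 0
      show ?case using s(3) alt[of 0] by auto
    next
      case (Suc j)
      have "u (s - int (2 * Suc j) * ?M) = 0"
        using bit_flip(2)[OF alt[of "Suc (2 * j)", symmetric]] Suc by simp
      then show ?case using alt[of "2 * Suc j"] by auto
    qed
    \<comment> \<open>Half a word is a block, a single digit and a block; passing to the next
      \<open>j\<close> complements it.\<close>
    have half: "u (s - int j * ?M - n - 1 + int k + 1)
        = (if k = N then u (s - int j * ?M) else u (s - int j * ?M) + 1)" if "k < 2 * N + 1" for j k
    proof -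
      consider "k < N" | "k = N" | "k > N" by linarith
      then show ?thesis
      proof cases
        case 1
        have "u (s - int j * ?M - n - 1 + int k + 1) \<noteq> u (s - int j * ?M - n - 1)"
          by (rule run_neq[OF s(2)]) (use 1 N in auto)
        then show ?thesis using mid[of j] 1 by (auto simp del: add_diff_cancel_left' diff_add_cancel)
      next
        case 2
        then have eq: "s - int j * ?M - n - 1 + int k + 1 = s - int j * ?M" using N by simp
        show ?thesis by (subst eq) (simp add: 2)
      next
        case 3
        have "u (s - int j * ?M - n - 1 + int k + 1) \<noteq> u (s - int j * ?M)"
          by (rule run_neq[OF s(1)]) (use 3 that N in auto)
        then show ?thesis using 3 by (auto simp del: add_diff_cancel_left' diff_add_cancel)
      qed
    qed
    let ?w = "replicate N 0 @ [1] @ replicate N 0 @ replicate N 1 @ [0] @ replicate N 1 :: bit list"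
    show ?thesis
    proof (rule *[of ?w "s - ?M - n"])
      fix j k
      assume k: "k < length ?w"
      let ?t = "s - ?M - n - int j * int (length ?w) + int k"
      show "u ?t = ?w ! k"
      proof (cases "k < 2 * N + 1")
        case True
        have t: "?t = s - int (Suc (2 * j)) * ?M - n - 1 + int k + 1"
          using N(1) by (simp add: algebra_simps)
        have "u ?t = (if k = N then 1 else 0)"
          unfolding t half[OF True] using col[of j] by simp
        then show ?thesis using True by (auto simp: nth_append nth_Cons')
      next
        case False
        define k' where "k' = k - (2 * N + 1)"
        have k': "k = k' + 2 * N + 1" "k' < 2 * N + 1" using False k by (auto simp: k'_def)
        have t: "?t = s - int (2 * j) * ?M - n - 1 + int k' + 1"
          using N(1) k'(1) by (simp add: algebra_simps)
        have "u ?t = (if k' = N then 0 else 1)"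
          unfolding t half[OF k'(2)] using col[of j] by simp
        then show ?thesis using k' by (auto simp: nth_append nth_Cons')
      qed
    qed (use N in \<open>auto simp: special_words_def\<close>)
  qed
qed

end

section \<open>Longest runs, and sequences without three equal neighbours\<close>

lemma longest_run:
  assumes u: "periodic_mixed u" and N: "\<forall>i. 0 \<le> i \<and> i < int N \<longrightarrow> u (s + i) = u s"
  obtains n s where "N \<le> n" "\<And>i. 0 \<le> i \<Longrightarrow> i < int n \<Longrightarrow> u (s + i) = u s"
    "\<And>s. \<exists>i. 0 \<le> i \<and> i < int n + 1 \<and> u (s + i) \<noteq> u s"
proof -
  define R where "R l \<longleftrightarrow> (\<exists>s. \<forall>i. 0 \<le> i \<and> i < int l \<longrightarrow> u (s + i) = u s)" for l
  obtain L where L: "L > 0" "\<And>i. u (i + L) = u i"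
    using u by (auto simp: periodic_mixed_def)
  \<comment> \<open>A run longer than the period would make the sequence constant.\<close>
  have bound: "l \<le> nat L" if Rl: "R l" for l
  proof (rule ccontr)
    assume l: "\<not> l \<le> nat L"
    obtain s where s: "\<And>i. 0 \<le> i \<Longrightarrow> i < int l \<Longrightarrow> u (s + i) = u s"
      using Rl unfolding R_def by blast
    have "u t = u s" for t
    proof -
      have "u t = u (s + (t - s) mod L + ((t - s) div L) * L)" by simp
      also have "\<dots> = u (s + (t - s) mod L)"
        by (rule periodic_add_mult) (rule L(2))
      also have "\<dots> = u s"
        by (rule s) (use L(1) l pos_mod_bound[of L "t - s"] pos_mod_sign[of L "t - s"] in linarith)+
      finally show ?thesis .
    qed
    then show False using u unfolding periodic_mixed_def by (metis zero_neq_one)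
  qed
  have RN: "R N" using N unfolding R_def by blast
  define n where "n = (GREATEST l. R l)"
  have "R n" unfolding n_def by (rule GreatestI_nat[of R N, OF RN]) (rule bound)
  moreover have "N \<le> n" unfolding n_def by (rule Greatest_le_nat[of R N, OF RN]) (rule bound)
  moreover have "\<not> R (n + 1)"
    using Greatest_le_nat[of R "n + 1" "nat L"] bound unfolding n_def by fastforce
  ultimately show ?thesis using that unfolding R_def by (auto simp: algebra_simps)
qed

text \<open>Two one-sided dependent choices starting from \<open>x0\<close>, one for
  \<open>R\<close> and one for its converse, are glued at index 0.\<close>

lemma biinfinite_chain:
  assumes "x0 \<in> S" "\<And>x. x \<in> S \<Longrightarrow> \<exists>y\<in>S. R x y" "\<And>x. x \<in> S \<Longrightarrow> \<exists>y\<in>S. R y x"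
  shows "\<exists>c :: int \<Rightarrow> 'a. \<forall>j. R (c j) (c (j + 1))"
proof -
  have "\<exists>f. f 0 = x0 \<and> (\<forall>k. Q (f k) (f (Suc k)))" if "\<And>x. x \<in> S \<Longrightarrow> \<exists>y\<in>S. Q x y" for Q
  proof -
    have "\<exists>f. \<forall>k. (f k \<in> S \<and> (k = 0 \<longrightarrow> f k = x0)) \<and> Q (f k) (f (Suc k))"
      by (rule dependent_nat_choice[of "\<lambda>k x. x \<in> S \<and> (k = 0 \<longrightarrow> x = x0)" "\<lambda>_. Q"])
        (use assms(1) that in auto)
    then show ?thesis by blast
  qed
  from this[of R] this[of "\<lambda>x y. R y x"] obtain f g where
    f: "f 0 = x0" "\<And>k. R (f k) (f (Suc k))" and g: "g 0 = x0" "\<And>k. R (g (Suc k)) (g k)"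
    using assms(2,3) by metis
  define c where "c j = (if j \<ge> 0 then f (nat j) else g (nat (- j)))" for j
  have "R (c j) (c (j + 1))" for j
  proof (cases "j \<ge> 0")
    case True
    then show ?thesis using f(2)[of "nat j"] by (simp add: c_def nat_add_distrib)
  next
    case False
    define k where "k = nat (- (j + 1))"
    have k: "j = - int k - 1" using False by (simp add: k_def)
    have "nat (- j) = Suc k" using k by simp
    then have "c j = g (Suc k)" using False by (simp add: c_def)
    moreover have "c (j + 1) = g k" using k f(1) g(1) by (cases "k = 0") (auto simp: c_def)
    ultimately show ?thesis using g(2) by simp
  qed
  then show ?thesis by blast
qed

text \<open>Cutting before each 0 that follows a 1 leaves pieces 0^a1^b, and all runs have length at
  most 2. \<open>S\<close> is the set of cuts.\<close>

lemma no_triple_in_bi_star: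
  assumes u: "periodic_mixed u" and no3: "\<And>s. \<not> (u (s + 1) = u s \<and> u (s + 2) = u s)"
  shows "u \<in> bi_star {[0, 1], [0, 0, 1], [0, 1, 1], [0, 0, 1, 1]}" (is "_ \<in> bi_star ?W")
proof -
  define S where "S = {i. u (i - 1) = 1 \<and> u i = 0}"
  define R where "R i i' \<longleftrightarrow> i < i' \<and> map u [i..i' - 1] \<in> ?W" for i i'
  have word: "R i (i + 2)" if "u i = 0" "u (i + 1) = 1" for i
    using that by (simp add: R_def upto.simps)
  have word1: "R i (i + 3)" if "u i = 0" "u (i + 1) = b" "u (i + 2) = 1" for i b
    using that by (cases "b = 0") (simp_all add: R_def upto.simps add.commute)
  have word2: "R i (i + 4)" if "u i = 0" "u (i + 1) = 0" "u (i + 2) = 1" "u (i + 3) = 1" for i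
    using that by (simp add: R_def upto.simps add.commute)
  have bit: "b = 0 \<or> b = 1" for b :: bit by auto
  have nxt: "\<exists>i'\<in>S. R i i'" if "i \<in> S" for i
  proof -
    have i: "u (i - 1) = 1" "u i = 0" using that by (auto simp: S_def algebra_simps)
    note n = no3[of i] no3[of "i + 1"] no3[of "i + 2"]
    show ?thesis
    proof (cases "u (i + 1) = 0")
      case True
      then have 2: "u (i + 2) = 1" using n i by auto
      show ?thesis
      proof (cases "u (i + 3) = 0")
        case True
        then show ?thesis using word1[OF i(2) refl 2] 2
          by (intro bexI[of _ "i + 3"]) (auto simp: S_def algebra_simps)
      next
        case False
        then have "u (i + 4) = 0" using n 2 by (auto simp: add.assoc)
        then show ?thesis using word2[of i] True False i 2
          by (intro bexI[of _ "i + 4"]) (auto simp: S_def algebra_simps)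
      qed
    next
      case False
      then have 1: "u (i + 1) = 1" by auto
      show ?thesis
      proof (cases "u (i + 2) = 0")
        case True
        then show ?thesis using word[OF i(2) 1] 1
          by (intro bexI[of _ "i + 2"]) (auto simp: S_def algebra_simps)
      next
        case False
        then have "u (i + 3) = 0" using n 1 by (auto simp: add.assoc)
        then show ?thesis using word1[OF i(2) 1] False
          by (intro bexI[of _ "i + 3"]) (auto simp: S_def algebra_simps)
      qed
    qed
  qed
  have prv: "\<exists>i'\<in>S. R i' i" if "i \<in> S" for i
  proof -
    have i: "u (i - 1) = 1" "u i = 0" using that by (auto simp: S_def algebra_simps)
    note n = no3[of "i - 3"] no3[of "i - 4"] no3[of "i - 5"]
    show ?thesis
    proof (cases "u (i - 2) = 0")
      case True
      show ?thesis
      proof (cases "u (i - 3) = 0")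
        case False
        then show ?thesis using word[of "i - 2"] True i
          by (intro bexI[of _ "i - 2"]) (auto simp: S_def algebra_simps)
      next
        case 2: True
        then have "u (i - 4) = 1" using n True by auto
        then show ?thesis using word1[of "i - 3" 0] True 2 i
          by (intro bexI[of _ "i - 3"]) (auto simp: S_def algebra_simps)
      qed
    next
      case False
      then have 1: "u (i - 2) = 1" by auto
      then have 3: "u (i - 3) = 0" using n i by auto
      show ?thesis
      proof (cases "u (i - 4) = 0")
        case False
        then show ?thesis using word1[of "i - 3" 1] 1 3 i
          by (intro bexI[of _ "i - 3"]) (auto simp: S_def algebra_simps)
      next
        case True
        then have "u (i - 5) = 1" using n 3 by auto
        then show ?thesis using word2[of "i - 4"] True 1 3 i
          by (intro bexI[of _ "i - 4"]) (auto simp: S_def algebra_simps)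
      qed
    qed
  qed
  obtain x0 where x0: "x0 \<in> S"
  proof -
    obtain a where a: "u a = 1" using u by (auto simp: periodic_mixed_def)
    show ?thesis
    proof (cases "u (a + 1) = 0")
      case True
      then show ?thesis using a that[of "a + 1"] by (simp add: S_def)
    next
      case False
      then have "u (a + 2) = 0" using no3[of a] a by auto
      then show ?thesis using False that[of "a + 2"] by (simp add: S_def algebra_simps)
    qed
  qed
  have "\<exists>c :: int \<Rightarrow> int. \<forall>j. R (c j) (c (j + 1))"
    by (rule biinfinite_chain[of x0 S R, OF x0]) (erule nxt, erule prv)
  then obtain c :: "int \<Rightarrow> int" where c: "\<And>j. R (c j) (c (j + 1))" by blast
  have "strict_mono c"
  proof (rule strict_monoI)
    fix i j :: int
    assume "i < j"
    then show "c i < c j"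
    proof (induction j rule: int_gr_induct)
      case base
      show ?case using c[of i] by (simp add: R_def)
    next
      case (step j)
      then show ?case using c[of j] by (simp add: R_def)
    qed
  qed
  then show ?thesis using c unfolding bi_star_def R_def by blast
qed

section \<open>The polygons\<close>

lemma tm_number_bin: "tm_number k = bin (\<lambda>n. thue_morse (n mod 2 ^ k))"
  by (simp add: tm_number_def bin_def)

lemma bin_prefix6:
  "bin a = digit (a 0) / 2 + digit (a 1) / 4 + digit (a 2) / 8 + digit (a 3) / 16 + digit (a 4) / 32
     + digit (a 5) / 64 + bin (\<lambda>n. a (n + 6)) / 64"
  using bin_rec[of a] bin_rec[of "\<lambda>n. a (n + 1)"] bin_rec[of "\<lambda>n. a (n + 2)"]
    bin_rec[of "\<lambda>n. a (n + 3)"] bin_rec[of "\<lambda>n. a (n + 4)"] bin_rec[of "\<lambda>n. a (n + 5)"]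
  by (simp add: numeral_eq_Suc)

lemma thue_morse_small: "thue_morse 1 = 1" "thue_morse (Suc 0) = 1" "thue_morse 2 = 1" "thue_morse 3 = 0"
  "thue_morse 4 = 1" "thue_morse 5 = 0"
proof -
  show 1: "thue_morse 1 = 1" using thue_morse_odd[of 0] by simp
  then show "thue_morse (Suc 0) = 1" by simp
  show 2: "thue_morse 2 = 1" using thue_morse_even[of 1] 1 by simp
  show "thue_morse 3 = 0" using thue_morse_odd[of 1] 1 by simp
  show "thue_morse 4 = 1" using thue_morse_even[of 2] 2 by simp
  show "thue_morse 5 = 0" using thue_morse_odd[of 2] 2 by simp
qed

lemma tm_number_1: "tm_number 1 = 1/3"
proof -
  have "(n + 6) mod 2 = n mod 2" for n :: nat by presburger
  then show ?thesis
    using bin_prefix6[of "\<lambda>n. thue_morse (n mod 2 ^ 1)"]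
    by (simp add: tm_number_bin thue_morse_small)
qed

lemma tm_number_2: "tm_number 2 = 2/5"
proof -
  let ?a = "\<lambda>n. thue_morse (n mod 2 ^ 2)"
  have p: "(n + 4) mod 4 = n mod 4" for n :: nat by presburger
  have "bin ?a = 3/8 + bin (\<lambda>n. ?a (n + 4)) / 16"
    using bin_rec[of ?a] bin_rec[of "\<lambda>n. ?a (n + 1)"] bin_rec[of "\<lambda>n. ?a (n + 2)"]
      bin_rec[of "\<lambda>n. ?a (n + 3)"]
    by (simp add: add.commute[of _ 3] thue_morse_small(2-) thue_morse_small(3)[unfolded numeral_2_eq_2])
  then show ?thesis by (simp add: p tm_number_bin)
qed

text \<open>For \<open>k \<ge> 3\<close> the expansion begins 0.011010, that is 26/64, and the
  remaining digits contribute at most 1/64.\<close>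

lemma tm_number_le:
  assumes "k \<ge> 2"
  shows "tm_number k \<le> 27/64"
proof (cases "k = 2")
  case True
  then show ?thesis by (simp add: tm_number_2)
next
  case False
  have "(2 :: nat) ^ 3 \<le> 2 ^ k" using assms False by (intro power_increasing) auto
  then have "n mod 2 ^ k = n" if "n < 6" for n :: nat using that by simp
  then have "tm_number k = 26/64 + bin (\<lambda>n. thue_morse ((n + 6) mod 2 ^ k)) / 64"
    unfolding tm_number_bin using bin_prefix6[of "\<lambda>n. thue_morse (n mod 2 ^ k)"]
    using assms by (simp add: thue_morse_small)
  then show ?thesis using bin_le_1[of "\<lambda>n. thue_morse ((n + 6) mod 2 ^ k)"] by simp
qed

lemma tm_number_less_half: "k \<ge> 1 \<Longrightarrow> tm_number k < 1/2"
  using tm_number_le[of k] tm_number_1 by (cases "k = 1") auto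

text \<open>By \<open>coding_complement\<close>, exchanging the digits is this point reflection at
  (1/2, 1/2); it reduces the case \<open>u s = 1\<close> to \<open>u s = 0\<close>.\<close>

lemma P_reflect: "(1 - x, 1 - y) \<in> P k \<longleftrightarrow> (x, y) \<in> P k"
  by (auto simp: P_def unit_square_def)

lemma coding_complement:
  "coding (shift m (\<lambda>i. u i + 1)) = (1 - fst (coding (shift m u)), 1 - snd (coding (shift m u)))"
  unfolding coding_shift bin_complement by simp

text \<open>If \<open>u s = 0\<close> is the digit x_1, then x = \<open>?Z / 2\<close> = (1 +
  \<open>?z\<close>)/4. Now \<open>p\<close> gives y < \<open>?Z\<close> = 2x, and \<open>q\<close>
  gives 1 - y < \<open>?z\<close> = 4x - 1. The other two edge inequalities follow from x < 1/2 and
  0 \<le> y < 1.\<close>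

lemma avoid_P:
  assumes u: "periodic_mixed u" and av: "\<And>m. coding (shift m u) \<notin> P k" and k: "k \<ge> 1"
    and strip: "\<And>i. 1 \<le> i \<Longrightarrow> i \<le> (if k = 1 then 2 else 3) \<Longrightarrow> u (s + i) \<noteq> u s"
    and pq: "0 \<le> p" "0 \<le> q"
    and p: "\<And>i. 0 \<le> i \<Longrightarrow> i < p \<Longrightarrow> u (s - 1 - i) = u (s + 1 + i)"
      "u (s - 1 - p) = u s" "u (s + 1 + p) \<noteq> u s"
    and q: "\<And>i. 0 \<le> i \<Longrightarrow> i < q \<Longrightarrow> u (s - 1 - i) \<noteq> u (s + 2 + i)"
      "u (s - 1 - q) \<noteq> u s" "u (s + 2 + q) \<noteq> u s"
  shows False
proof -
  \<comment> \<open>Only equalities between digits enter through \<open>vu\<close>, so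
    \<open>v\<close> may be \<open>u\<close> or its complement.\<close>
  have main: False if v: "periodic_mixed v" "\<And>m. coding (shift m v) \<notin> P k" "v s = 0"
    and vu: "\<And>i j. v i = v j \<longleftrightarrow> u i = u j" for v
  proof -
    let ?y = "bin (\<lambda>n. v (s - 1 - int n))" and ?Z = "bin (\<lambda>n. v (s + 1 + int n))"
      and ?z = "bin (\<lambda>n. v (s + 2 + int n))"
    have v1: "v (s + i) = 1" if "1 \<le> i" "i \<le> (if k = 1 then 2 else 3)" for i
      using strip[OF that] vu v(3) by (metis bit_not_zero_iff)
    \<comment> \<open>Supplies the later zero that \<open>bin_less\<close> demands, for the past and
      for its complement.\<close>
    have past: "\<exists>j>r. v (s - 1 - int j) = b" for r b
    proof -
      obtain i where "i < s - 1 - int r" "v i = b" using periodic_mixed_occurs(2)[OF v(1)] by blast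
      then show ?thesis by (intro exI[of _ "nat (s - 1 - i)"]) auto
    qed
    obtain i where "i > s + 2" "v i = 0" using periodic_mixed_occurs(1)[OF v(1)] by blast
    then have z1: "?z < 1" by (intro bin_less_1[of _ "nat (i - (s + 2))"]) simp
    have Z: "?Z = (1 + ?z) / 2"
      using bin_rec[of "\<lambda>n. v (s + 1 + int n)"] v1[of 1] by (simp add: algebra_simps)
    have X: "bin (\<lambda>n. v (s + int n)) = ?Z / 2"
      using bin_rec[of "\<lambda>n. v (s + int n)"] v(3) by (simp add: algebra_simps)
    obtain j where "j > nat p" "v (s - 1 - int j) = 0" using past by blast
    moreover have "v (s - 1 - int i) = v (s + 1 + int i)" if "i < nat p" for i
      using vu p(1)[of "int i"] that by simp
    moreover have "v (s - 1 - p) = 0" using vu[of "s - 1 - p" s] p(2) v(3) by simp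
    moreover have "v (s + 1 + p) = 1" using vu[of "s + 1 + p" s] p(3) v(3) by simp
    ultimately have yZ: "?y < ?Z"
      using pq by (intro bin_less[of "nat p" _ _ j]) auto
    obtain j where "j > nat q" "v (s - 1 - int j) = 1" using past by blast
    moreover have "v (s - 1 - int i) + 1 = v (s + 2 + int i)" if "i < nat q" for i
    proof -
      have "v (s - 1 - int i) \<noteq> v (s + 2 + int i)" using vu q(1)[of "int i"] that by simp
      then show ?thesis by (cases "v (s + 2 + int i) = 0") auto
    qed
    moreover have "v (s - 1 - q) = 1" using vu[of "s - 1 - q" s] q(2) v(3) by simp
    moreover have "v (s + 2 + q) = 1" using vu[of "s + 2 + q" s] q(3) v(3) by simp
    ultimately have "bin (\<lambda>n. v (s - 1 - int n) + 1) < ?z"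
      using pq by (intro bin_less[of "nat q" _ _ j]) auto
    then have yz: "1 - ?y < ?z" unfolding bin_complement .
    obtain j where "j > 0" "v (s - 1 - int j) = 0" using past by blast
    then have y1: "?y < 1" by (intro bin_less_1)
    have y0: "?y \<ge> 0" "?Z \<ge> 0" by (rule bin_nonneg)+
    \<comment> \<open>The abscissa (1 + \<open>?z\<close>)/4 is at least 3/8 > 1/3 if
      \<open>k = 1\<close>, and at least 7/16 > 27/64 otherwise.\<close>
    have t: "tm_number k < ?Z / 2"
    proof (cases "k = 1")
      case True
      have "?z \<ge> 1/2" using bin_rec[of "\<lambda>n. v (s + 2 + int n)"] v1[of 2] True
          bin_nonneg[of "\<lambda>n. v (s + 2 + int (Suc n))"] by simp
      then show ?thesis using True Z tm_number_1 by simp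
    next
      case False
      have "?z \<ge> 3/4" using bin_rec[of "\<lambda>n. v (s + 2 + int n)"] v1[of 2] v1[of 3] False
          bin_rec[of "\<lambda>n. v (s + 2 + int (Suc n))"]
          bin_nonneg[of "\<lambda>n. v (s + 2 + int (Suc (Suc n)))"] by (simp add: algebra_simps)
      then show ?thesis using False k Z tm_number_le[of k] by simp
    qed
    have "coding (shift (s - 1) v) = (?Z / 2, ?y)"
      by (simp add: coding_shift X)
    moreover have "(?Z / 2, ?y) \<in> P k"
      using t Z z1 yZ yz y1 y0 tm_number_less_half[OF k] by (auto simp: P_def unit_square_def)
    ultimately show False using v(2) by metis
  qed
  show False
  proof (cases "u s = 0")
    case True
    then show ?thesis using main[OF u av] by simp
  next
    case False
    show ?thesis
    proof (rule main[OF periodic_mixed_complement[OF u]])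
      show "coding (shift m (\<lambda>i. u i + 1)) \<notin> P k" for m
        unfolding coding_complement P_reflect using av[of m] by simp
      show "u s + 1 = 0" using False by simp
    qed (simp only: add_right_cancel)
  qed
qed

text \<open>The segment from a point satisfying the weak inequalities to the centre \<open>(1/2, 1/2)\<close> runs
  inside the polygon.\<close>

lemma closure_P:
  assumes k: "k \<ge> 1" and q: "2 * x - 1 \<le> y" "y \<le> 2 * x" "2 - 4 * x \<le> y" "y \<le> 3 - 4 * x"
    "tm_number k \<le> x" "x \<le> 1 - tm_number k"
  shows "(x, y) \<in> closure (P k)"
proof -
  define e where "e m = inverse (real (Suc m))" for m
  define f where "f m = (x + e m * (1/2 - x), y + e m * (1/2 - y))" for m
  have e: "0 < e m" "e m \<le> 1" for m
    by (auto simp: e_def field_simps)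
  have "e \<longlonglongrightarrow> 0" unfolding e_def by (rule LIMSEQ_inverse_real_of_nat)
  then have "f \<longlonglongrightarrow> (x + 0 * (1/2 - x), y + 0 * (1/2 - y))"
    unfolding f_def by (intro tendsto_intros)
  then have "f \<longlonglongrightarrow> (x, y)" by simp
  moreover have "f m \<in> P k" for m
  proof -
    have mix: "0 < (1 - e m) * A + e m * B" if "0 \<le> A" "0 < B" for A B
      using that e[of m] by (simp add: add_nonneg_pos)
    \<comment> \<open>The factor after \<open>e m\<close> is the slack of the respective inequality
      at the centre.\<close>
    have "0 < (1 - e m) * (y - (2 * x - 1)) + e m * (1/2)"
      "0 < (1 - e m) * (2 * x - y) + e m * (1/2)"
      "0 < (1 - e m) * (y - (2 - 4 * x)) + e m * (1/2)"
      "0 < (1 - e m) * (3 - 4 * x - y) + e m * (1/2)"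
      "0 < (1 - e m) * (x - tm_number k) + e m * (1/2 - tm_number k)"
      "0 < (1 - e m) * (1 - tm_number k - x) + e m * (1/2 - tm_number k)"
      using q tm_number_less_half[OF k] by (intro mix; simp)+
    then show ?thesis
      by (auto simp: P_def unit_square_def f_def algebra_simps)
  qed
  ultimately show ?thesis by (auto simp: closure_sequential)
qed

section \<open>\<open>P 1\<close> as an open parallelogram\<close>

definition parallelogram :: "(real \<times> real) set" where
  "parallelogram = {(x, y). 2 * x - 1 \<le> y \<and> y \<le> 2 * x \<and> 2 - 4 * x \<le> y \<and> y \<le> 3 - 4 * x}"

lemma convex_hull_parallelogram:
  "convex hull {(1/3, 2/3), (1/2, 1), (2/3, 1/3), (1/2, 0)} = parallelogram"
proof
  have "convex parallelogram"
  proof (rule convexI)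
    fix p q :: "real \<times> real" and a b :: real
    assume pq: "p \<in> parallelogram" "q \<in> parallelogram" and ab: "0 \<le> a" "0 \<le> b" "a + b = 1"
    obtain x y x' y' where [simp]: "p = (x, y)" "q = (x', y')" by fastforce
    have b: "b = 1 - a" using ab by simp
    have mix: "0 \<le> a * A + b * B" if "0 \<le> A" "0 \<le> B" for A B
      using that ab by simp
    have "0 \<le> a * (y - (2 * x - 1)) + b * (y' - (2 * x' - 1))"
      "0 \<le> a * (2 * x - y) + b * (2 * x' - y')"
      "0 \<le> a * (y - (2 - 4 * x)) + b * (y' - (2 - 4 * x'))"
      "0 \<le> a * (3 - 4 * x - y) + b * (3 - 4 * x' - y')"
      using pq by (intro mix; simp add: parallelogram_def)+
    then show "a *\<^sub>R p + b *\<^sub>R q \<in> parallelogram"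
      unfolding b by (auto simp: parallelogram_def algebra_simps)
  qed
  then show "convex hull {(1/3, 2/3), (1/2, 1), (2/3, 1/3), (1/2, 0)} \<subseteq> parallelogram"
    by (intro hull_minimal) (auto simp: parallelogram_def)
  show "parallelogram \<subseteq> convex hull {(1/3, 2/3), (1/2, 1), (2/3, 1/3), (1/2, 0)}" (is "_ \<subseteq> ?H")
  proof
    fix p assume p: "p \<in> parallelogram"
    obtain x y where xy: "p = (x, y)" by fastforce
    \<comment> \<open>In the coordinates \<open>a\<close>, \<open>b\<close> the parallelogram
      becomes the unit square and its vertices the corners, so bilinear interpolation gives the
      weights.\<close>
    define a where "a = 2 * x - y"
    define b where "b = 4 * x + y - 2"
    have ab: "0 \<le> a" "a \<le> 1" "0 \<le> b" "b \<le> 1"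
      using p by (auto simp: xy a_def b_def parallelogram_def)
    have H: "(1/3, 2/3) \<in> ?H" "(1/2, 1) \<in> ?H" "(2/3, 1/3) \<in> ?H" "(1/2, 0) \<in> ?H"
      by (auto intro: hull_inc)
    have "(1 - b) *\<^sub>R (1/3, 2/3) + b *\<^sub>R (1/2, 1) \<in> ?H"
      "(1 - b) *\<^sub>R (1/2, 0) + b *\<^sub>R (2/3, 1/3) \<in> ?H"
      using ab H by (intro convexD convex_convex_hull; simp)+
    from convexD[OF convex_convex_hull this, of "1 - a" a]
    have "(1 - a) *\<^sub>R ((1 - b) *\<^sub>R (1/3, 2/3) + b *\<^sub>R (1/2, 1))
        + a *\<^sub>R ((1 - b) *\<^sub>R (1/2, 0) + b *\<^sub>R (2/3, 1/3)) \<in> ?H"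
      using ab by simp
    moreover have "(1 - a) *\<^sub>R ((1 - b) *\<^sub>R (1/3, 2/3) + b *\<^sub>R (1/2, 1))
        + a *\<^sub>R ((1 - b) *\<^sub>R (1/2, 0) + b *\<^sub>R (2/3, 1/3)) = (x, y)"
    proof -
      have "x = 1/3 + a/6 + b/6" "y = 2/3 - 2*a/3 + b/3" by (simp_all add: a_def b_def field_simps)
      then show ?thesis by (simp add: field_simps)
    qed
    ultimately show "p \<in> ?H" by (simp add: xy)
  qed
qed

lemma P_1_interior: "P 1 = interior parallelogram"
proof
  \<comment> \<open>The edge inequalities combine to 1/3 < x < 2/3 and 0 < y < 1, so
    \<open>P 1\<close> is an intersection of four open half-planes.\<close>
  have P1: "P 1 = {p. 2 * fst p - 1 < snd p \<and> snd p < 2 * fst p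
      \<and> 2 - 4 * fst p < snd p \<and> snd p < 3 - 4 * fst p}"
    by (auto simp: P_def unit_square_def tm_number_1[unfolded One_nat_def])
  have "open (P 1)" unfolding P1
    by (intro open_Collect_conj open_Collect_less continuous_intros)
  then show "P 1 \<subseteq> interior parallelogram"
    by (intro interior_maximal) (auto simp: P_def parallelogram_def)
  show "interior parallelogram \<subseteq> P 1"
  proof
    fix p assume "p \<in> interior parallelogram"
    then obtain e where e: "e > 0" "ball p e \<subseteq> parallelogram" by (auto simp: mem_interior)
    obtain x y where xy: "p = (x, y)" by fastforce
    \<comment> \<open>No edge is vertical, so moving up and down by \<open>e / 2\<close> makes all
      four inequalities strict at \<open>p\<close>.\<close>
    have "(x, y + e / 2) \<in> parallelogram" "(x, y - e / 2) \<in> parallelogram"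
      using e by (auto intro!: subsetD[OF e(2)] simp: xy dist_Pair_Pair dist_real_def)
    then show "p \<in> P 1" using e(1) unfolding P1 by (auto simp: xy parallelogram_def)
  qed
qed

section \<open>Cycles of the special words\<close>

text \<open>The longest run has length \<open>n \<ge> N\<close>, which is enough for the
  \<open>strip\<close> condition of \<open>avoid_P\<close>; this yields the assumptions of
  \<open>extremal_runs\<close>.\<close>

lemma avoiding_orbit_special:
  assumes u: "periodic_mixed u" and av: "\<And>m. coding (shift m u) \<notin> P k" and k: "k \<ge> 1"
    and N: "\<forall>i. 0 \<le> i \<and> i < int N \<longrightarrow> u (s + i) = u s" "N = (if k = 1 then 2 else 3)"
  shows "\<exists>n\<ge>1. \<exists>w\<in>special_words n. range (\<lambda>m. coding (shift m u)) = cycle_of_word w"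
proof -
  obtain n t where n: "N \<le> n" "\<And>i. 0 \<le> i \<Longrightarrow> i < int n \<Longrightarrow> u (t + i) = u t"
    "\<And>s. \<exists>i. 0 \<le> i \<and> i < int n + 1 \<and> u (s + i) \<noteq> u s"
    using longest_run[OF u N(1)] by blast
  have N2: "N \<ge> 2" using N(2) by simp
  interpret extremal_runs u "int n"
  proof
    show "2 \<le> int n" using n(1) N2 by simp
    show "\<exists>i. 1 \<le> i \<and> i \<le> int n \<and> u (s - i) \<noteq> u s" for s
    proof (rule ccontr)
      assume neg: "\<nexists>i. 1 \<le> i \<and> i \<le> int n \<and> u (s - i) \<noteq> u s"
      have eq: "u (s - i) = u s" if "0 \<le> i" "i \<le> int n" for i
        using neg that by (cases "i = 0") auto
      \<comment> \<open>Maximality counts forwards from a start, the locale backwards from an end,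
        hence \<open>s - int n\<close>.\<close>
      obtain i where "0 \<le> i" "i < int n + 1" "u (s - int n + i) \<noteq> u (s - int n)"
        using n(3) by blast
      then show False using eq[of "int n - i"] eq[of "int n"] by (simp add: algebra_simps)
    qed
    fix s p q :: int
    assume a: "\<forall>i. 1 \<le> i \<and> i \<le> int n \<longrightarrow> u (s + i) \<noteq> u s" "0 \<le> p" "0 \<le> q"
      "\<forall>i. 0 \<le> i \<and> i < p \<longrightarrow> u (s - 1 - i) = u (s + 1 + i)"
      "u (s - 1 - p) = u s" "u (s + 1 + p) \<noteq> u s"
      "\<forall>i. 0 \<le> i \<and> i < q \<longrightarrow> u (s - 1 - i) \<noteq> u (s + 2 + i)"
      "u (s - 1 - q) \<noteq> u s" "u (s + 2 + q) \<noteq> u s"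
    show False
    proof (rule avoid_P[OF u av k, of s p q])
      show "u (s + i) \<noteq> u s" if "1 \<le> i" "i \<le> (if k = 1 then 2 else 3)" for i
        using a(1) that n(1) N(2) by (auto split: if_splits)
    qed (use a in auto)
  qed
  have before: "u (t - 1) \<noteq> u t"
  proof
    assume eq: "u (t - 1) = u t"
    obtain i where i: "0 \<le> i" "i < int n + 1" "u (t - 1 + i) \<noteq> u (t - 1)" using n(3) by blast
    then have "i \<noteq> 0" by auto
    then show False using i eq n(2)[of "i - 1"] by (simp add: algebra_simps)
  qed
  have after: "u (t + int n) \<noteq> u t"
  proof
    assume eq: "u (t + int n) = u t"
    obtain i where i: "0 \<le> i" "i < int n + 1" "u (t + i) \<noteq> u t" using n(3) by blast
    then show False using n(2)[of i] eq by (cases "i = int n") auto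
  qed
  have "run (t - 1)"
    unfolding run_def
  proof (intro conjI allI impI)
    show "u (t - 1 + int n + 1) = u (t - 1)"
      using bit_eq_if_both_neq[OF after before] by simp
    show "u (t - 1 + i) \<noteq> u (t - 1)" if "1 \<le> i \<and> i \<le> int n" for i
      using n(2)[of "i - 1"] that before by (simp add: algebra_simps)
  qed
  moreover obtain L where L: "L > 0" "\<And>i. u (i + L) = u i"
    using u by (auto simp: periodic_mixed_def)
  ultimately obtain w p where "w \<in> special_words n" "\<And>i. u (p + i) = w ! nat (i mod int (length w))"
    using special_word_exists[of L "t - 1"] by auto
  then show ?thesis using cycle_of_word_eq[OF u] n(1) N2 by (metis le_trans one_le_numeral)
qed

text \<open>The case of longest run 1, below the bound \<open>n2\<close> of
  \<open>extremal_runs\<close>: the sequence has period 2.\<close>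

lemma alternating_special:
  assumes u: "periodic_mixed u" and alt: "\<And>i. u (i + 1) \<noteq> u i"
  shows "range (\<lambda>m. coding (shift m u)) = cycle_of_word [1, 0]"
proof -
  obtain p where p: "u p = 1" using u by (auto simp: periodic_mixed_def)
  have per: "u (i + 2) = u i" for i
    using alt[of i] alt[of "i + 1"] bit_eq_if_both_neq[of "u (i + 2)" "u (i + 1)" "u i"]
    by (simp add: add.assoc)
  have "u (p + i) = [1, 0] ! nat (i mod int (length [1, 0 :: bit]))" for i
  proof -
    have "u (p + i) = u (p + i mod 2 + (i div 2) * 2)" by (simp add: add.assoc)
    also have "\<dots> = u (p + i mod 2)" by (rule periodic_add_mult) (rule per)
    also have "\<dots> = [1, 0] ! nat (i mod 2)"
    proof (cases "i mod 2 = 0")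
      case False
      then have "i mod 2 = 1" by presburger
      then show ?thesis using p alt[of p] by simp
    qed (use p in simp)
    finally show ?thesis by simp
  qed
  then show ?thesis using cycle_of_word_eq[OF u] by blast
qed

section \<open>Symmetric borders of the special words\<close>

definition cyc :: "bit list \<Rightarrow> int \<Rightarrow> bit" where
  "cyc w t = w ! nat (t mod int (length w))"

lemma cyc_nat: "k < length w \<Longrightarrow> cyc w (int k) = w ! k"
  by (simp add: cyc_def)

text \<open>Modulo the length, \<open>- t - 1\<close> is the position mirrored within the
  word.\<close>

lemma cyc_antipalindrome:
  assumes "rev w = map (\<lambda>b. b + 1) w" "w \<noteq> []"
  shows "cyc w (- t - 1) = cyc w t + 1"
proof -
  define l where "l = int (length w)"
  define r where "r = t mod l"
  have l: "l > 0" using assms(2) by (simp add: l_def)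
  have r: "0 \<le> r" "r < l" using l by (auto simp: r_def)
  have "- t - 1 = (l - 1 - r) + (- (t div l) - 1) * l"
    using div_mult_mod_eq[of t l] by (simp add: r_def algebra_simps)
  then have "(- t - 1) mod l = (l - 1 - r) mod l" by (metis mod_mult_self1)
  also have "\<dots> = l - 1 - r" using r by (intro mod_pos_pos_trivial) auto
  finally have "cyc w (- t - 1) = w ! nat (l - 1 - r)" by (simp add: cyc_def l_def)
  also have "nat (l - 1 - r) = length w - Suc (nat r)" using r by (simp add: l_def)
  also have "w ! \<dots> = rev w ! nat r" using r by (simp add: rev_nth l_def)
  also have "\<dots> = w ! nat r + 1" unfolding assms(1) by (rule nth_map) (use r in \<open>simp add: l_def\<close>)
  finally show ?thesis by (simp add: cyc_def r_def l_def)
qed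

lemma periodic_seq_cyc: "periodic_seq w i = cyc w (i - 1)"
  by (simp add: periodic_seq_def cyc_def)

lemma periodic_mixed_periodic_seq:
  assumes "0 \<in> set w" "1 \<in> set w"
  shows "periodic_mixed (periodic_seq w)"
  unfolding periodic_mixed_def
proof (intro conjI)
  have "\<exists>i. periodic_seq w i = b" if "b \<in> set w" for b
  proof -
    obtain k where "k < length w" "w ! k = b" using \<open>b \<in> set w\<close> unfolding in_set_conv_nth by blast
    then show ?thesis by (intro exI[of _ "int k + 1"]) (simp add: periodic_seq_cyc cyc_nat)
  qed
  then show "\<exists>i. periodic_seq w i = 0" "\<exists>i. periodic_seq w i = 1" using assms by blast+
  have "periodic_seq w (i + int (length w)) = periodic_seq w i" for i
  proof -
    have eq: "i + int (length w) - 1 = i - 1 + int (length w)" by simp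
    show ?thesis unfolding periodic_seq_def eq mod_add_self2 ..
  qed
  moreover have "int (length w) > 0" using assms(1) by auto
  ultimately show "\<exists>L>0. \<forall>i. periodic_seq w (i + L) = periodic_seq w i" by blast
qed

text \<open>\<open>cyc\<close> starts the word at position 0 and \<open>periodic_seq\<close> at 1,
  so here \<open>m\<close> is the position of the digit x_1.\<close>

lemma coding_in_cycle_of_word:
  assumes "0 \<in> set w" "1 \<in> set w"
  shows "(bin (\<lambda>n. cyc w (m + int n)), bin (\<lambda>n. cyc w (m - 1 - int n))) \<in> cycle_of_word w"
proof -
  have "coding (shift m (periodic_seq w)) \<in> cycle_of_word w"
    unfolding cycle_of_word_def baker_orbit_coding[OF periodic_mixed_periodic_seq[OF assms]] by blast
  then show ?thesis by (simp add: coding_shift periodic_seq_cyc algebra_simps)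
qed

text \<open>These are the two edges meeting in the vertex (1/3, 2/3), cut down to the strip, and
  their reflections.\<close>

lemma border_points_in_closure:
  assumes "k \<ge> 1" "1/3 \<le> x" "x \<le> 1/2" "tm_number k \<le> x" "y = 2 * x \<or> y = 2 - 4 * x"
  shows "(x, y) \<in> closure (P k)" "(1 - x, 1 - y) \<in> closure (P k)"
  using assms tm_number_less_half[of k] by (auto intro!: closure_P)

text \<open>The divisibility condition makes \<open>x\<^sub>1x\<^sub>2\<close> the centre of an antisymmetry, so that
  \<open>y = 1 - z\<close> for \<open>x = 0.01z\<close> and the point lies on the edge \<open>y = 2 - 4x\<close>.\<close>

lemma antipalindrome_meets:
  assumes w: "rev w = map (\<lambda>b. b + 1) w" "w \<noteq> []" "0 \<in> set w" "1 \<in> set w"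
    and m: "int (length w) dvd 2 * m + 2" "cyc w m = 0" "cyc w (m + 1) = 1"
    and k: "k \<ge> 1" "1/3 \<le> bin (\<lambda>n. cyc w (m + int n))" "tm_number k \<le> bin (\<lambda>n. cyc w (m + int n))"
  shows "cycle_of_word w \<inter> closure (P k) \<noteq> {}"
proof -
  let ?x = "bin (\<lambda>n. cyc w (m + int n))" and ?z = "bin (\<lambda>n. cyc w (m + 2 + int n))"
  have "?x = (1 + ?z) / 4"
    using bin_rec[of "\<lambda>n. cyc w (m + int n)"] bin_rec[of "\<lambda>n. cyc w (m + 1 + int n)"] m
    by (simp add: algebra_simps)
  moreover have "bin (\<lambda>n. cyc w (m - 1 - int n)) = 1 - ?z"
  proof -
    have "cyc w (m - 1 - int n) = cyc w (m + 2 + int n) + 1" for n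
    proof -
      \<comment> \<open>Removing whole words turns \<open>m + 2 + int n\<close> into
        \<open>int n - m\<close>, whose mirror position is \<open>m - 1 - int n\<close>.\<close>
      obtain q where q: "2 * m + 2 = int (length w) * q" using m(1) by blast
      have eq: "m + 2 + int n = int n - m + int (length w) * q" using q by linarith
      have "cyc w (m + 2 + int n) = cyc w (int n - m)" unfolding eq by (simp add: cyc_def)
      then show ?thesis using cyc_antipalindrome[OF w(1,2), of "int n - m"] by (simp add: algebra_simps)
    qed
    then show ?thesis unfolding bin_complement[symmetric] by simp
  qed
  ultimately have "(?x, bin (\<lambda>n. cyc w (m - 1 - int n))) \<in> closure (P k)"
    using bin_le_1[of "\<lambda>n. cyc w (m + 2 + int n)"] k by (intro border_points_in_closure) auto
  then show ?thesis using coding_in_cycle_of_word[OF w(3,4), of m] by blast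
qed

text \<open>In the repetition of 01^n each 0 is a centre of reflection, so its past and future agree
  and y = 2x. The words 10^n follow by complement.\<close>

lemma cyc_single_meets:
  assumes n: "n \<ge> 1" and k: "k \<ge> 1"
    "1/3 \<le> bin (\<lambda>i. cyc (0 # replicate n 1) (int i))"
    "tm_number k \<le> bin (\<lambda>i. cyc (0 # replicate n 1) (int i))"
  shows "cycle_of_word (0 # replicate n 1) \<inter> closure (P k) \<noteq> {}"
    "cycle_of_word (1 # replicate n 0) \<inter> closure (P k) \<noteq> {}"
proof -
  let ?v = "0 # replicate n 1 :: bit list" and ?w = "1 # replicate n 0 :: bit list"
  let ?L = "int (Suc n)"
  let ?x = "bin (\<lambda>i. cyc ?v (int i))" and ?y = "bin (\<lambda>i. cyc ?v (- 1 - int i))"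
  have v: "cyc ?v t = (if ?L dvd t then 0 else 1)" and w: "cyc ?w t = cyc ?v t + 1" for t
  proof -
    define r where "r = nat (t mod ?L)"
    have "t mod ?L < ?L" by (rule pos_mod_bound) simp
    then have r: "r < Suc n" unfolding r_def by linarith
    have "cyc ?v t = ?v ! r" "cyc ?w t = ?w ! r" by (simp_all add: cyc_def r_def)
    moreover have "?L dvd t \<longleftrightarrow> r = 0"
      unfolding r_def dvd_eq_mod_eq_0 using pos_mod_sign[of ?L t] by linarith
    ultimately show "cyc ?v t = (if ?L dvd t then 0 else 1)" "cyc ?w t = cyc ?v t + 1"
      using r by (cases r; simp)+
  qed
  have "cyc ?v (- 1 - int i) = cyc ?v (int (Suc i))" for i
  proof -
    have "?L dvd - 1 - int i \<longleftrightarrow> ?L dvd - (- 1 - int i)" by (simp only: dvd_minus_iff)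
    also have "- (- 1 - int i) = int (Suc i)" by simp
    finally show ?thesis unfolding v by simp
  qed
  then have y: "?y = 2 * ?x"
    using bin_rec[of "\<lambda>i. cyc ?v (int i)"] v[of 0] by simp
  moreover have "?x \<le> 1/2" using y bin_le_1[of "\<lambda>i. cyc ?v (- 1 - int i)"] by simp
  ultimately have cl: "(?x, ?y) \<in> closure (P k)" "(1 - ?x, 1 - ?y) \<in> closure (P k)"
    using k by (auto intro!: border_points_in_closure)
  show "cycle_of_word ?v \<inter> closure (P k) \<noteq> {}"
    using coding_in_cycle_of_word[of ?v 0] cl(1) n by auto
  have "(1 - ?x, 1 - ?y) \<in> cycle_of_word ?w"
    using coding_in_cycle_of_word[of ?w 0] n unfolding w bin_complement by auto
  then show "cycle_of_word ?w \<inter> closure (P k) \<noteq> {}" using cl(2) by blast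
qed

lemma bin_ge_seven_sixteenths:
  assumes "a 1 = 1" "a 2 = 1" "a 3 = 1"
  shows "7/16 \<le> bin a"
  using bin_prefix6[of a] assms bin_nonneg[of "\<lambda>n. a (n + 6)"] digit_bounds(1)[of "a 0"]
    digit_bounds(1)[of "a 4"] digit_bounds(1)[of "a 5"] by simp

text \<open>27/64 is 0.011011, the bound of \<open>tm_number_le\<close>; for \<open>n = 2\<close>
  the centred words other than 1100 start with these digits.\<close>

lemma bin_ge_011011:
  assumes "a 1 = 1" "a 2 = 1" "a 4 = 1" "a 5 = 1"
  shows "27/64 \<le> bin a"
  using bin_prefix6[of a] assms bin_nonneg[of "\<lambda>n. a (n + 6)"] digit_bounds(1)[of "a 0"]
    digit_bounds(1)[of "a 3"] by simp

text \<open>In each case \<open>m\<close> is the shift that puts a border \<open>01\<close> lying on a symmetry axis of the periodic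
  sequence at \<open>x\<^sub>1x\<^sub>2\<close>.\<close>

definition centred :: "nat \<Rightarrow> bit list \<Rightarrow> int \<Rightarrow> bool" where
  "centred n w m \<longleftrightarrow> w = 0 # replicate n 1 \<and> m = 0
      \<or> w = replicate n 1 @ replicate n 0 \<and> m = - 1
      \<or> w = replicate n 0 @ [1] @ replicate n 0 @ replicate n 1 @ [0] @ replicate n 1 \<and> m = 2 * int n"

lemma rev_halves:
  "rev (replicate n 1 @ replicate n 0) = map (\<lambda>b. b + 1) (replicate n 1 @ replicate n (0 :: bit))"
  "rev (replicate n 0 @ [1] @ replicate n 0 @ replicate n 1 @ [0] @ replicate n 1)
    = map (\<lambda>b. b + 1) (replicate n 0 @ [1] @ replicate n 0 @ replicate n 1 @ [0] @ replicate n (1 :: bit))"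
  by simp_all

lemma centred_digits:
  assumes n: "n \<ge> 1" and c: "centred n w m"
  shows "cyc w m = 0" "1 \<le> i \<Longrightarrow> i \<le> n \<Longrightarrow> cyc w (m + int i) = 1"
proof -
  have "cyc w m = 0 \<and> (1 \<le> i \<and> i \<le> n \<longrightarrow> cyc w (m + int i) = 1)"
    using c unfolding centred_def
  proof (elim disjE conjE)
    assume w: "w = 0 # replicate n 1" "m = 0"
    show ?thesis using cyc_nat[of 0 w] cyc_nat[of i w] by (auto simp: w nth_Cons')
  next
    assume w: "w = replicate n 1 @ replicate n 0" "m = - 1"
    have "cyc w (- 0 - 1) = cyc w 0 + 1"
      by (rule cyc_antipalindrome) (use rev_halves(1) n w(1) in auto)
    moreover have "cyc w (int k) = 1" if "k < n" for k
      using cyc_nat[of k w] that by (simp add: w nth_append)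
    from this[of 0] this[of "i - 1"] have "cyc w 0 = 1" "1 \<le> i \<and> i \<le> n \<longrightarrow> cyc w (- 1 + int i) = 1"
      using n by (auto simp: of_nat_diff)
    ultimately show ?thesis by (simp add: w(2))
  next
    assume w: "w = replicate n 0 @ [1] @ replicate n 0 @ replicate n 1 @ [0] @ replicate n 1"
      "m = 2 * int n"
    show ?thesis using cyc_nat[of "2 * n" w] cyc_nat[of "2 * n + i" w] n
      by (auto simp: w nth_append nth_Cons')
  qed
  then show "cyc w m = 0" "1 \<le> i \<Longrightarrow> i \<le> n \<Longrightarrow> cyc w (m + int i) = 1" by auto
qed

text \<open>For \<open>n = 1\<close> the digits alternate. The abscissa begins 0.0111 for
  \<open>n \<ge> 3\<close> and 0.011011 for \<open>n = 2\<close>, except that 1100 gives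
  0.01100110... = 2/5 = \<open>tm_number 2\<close>.\<close>

lemma centred_abscissa:
  assumes n: "n \<ge> 1" and c: "centred n w m"
  shows "n = 1 \<Longrightarrow> bin (\<lambda>i. cyc w (m + int i)) = 1/3"
    and "n \<ge> 2 \<Longrightarrow> w \<noteq> [1, 1, 0, 0] \<Longrightarrow> bin (\<lambda>i. cyc w (m + int i)) \<ge> 27/64"
    and "w = [1, 1, 0, 0] \<Longrightarrow> bin (\<lambda>i. cyc w (m + int i)) = 2/5"
proof -
  show "bin (\<lambda>i. cyc w (m + int i)) = 1/3" if "n = 1"
  proof -
    let ?a = "\<lambda>i. cyc w (m + int i)"
    have w: "w = [0, 1] \<and> m = 0 \<or> w = [1, 0] \<and> m = - 1 \<or> w = [0, 1, 0, 1, 0, 1] \<and> m = 2"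
      using c that by (auto simp: centred_def)
    have "?a (i + 2) = ?a i" for i
    proof -
      have "(m + int (i + 2)) mod 2 = (m + int i) mod 2" by presburger
      moreover have "cyc w t = w ! nat (t mod 2)" for t
      proof -
        have "t mod 6 \<in> {0, 1, 2, 3, 4, 5}" by auto
        moreover have "t mod 2 = t mod 6 mod 2" by presburger
        ultimately show ?thesis using w by (auto simp: cyc_def)
      qed
      ultimately show ?thesis by simp
    qed
    then have "bin ?a = (digit (?a 0) + (digit (?a 1) + bin ?a) / 2) / 2"
      using bin_rec[of ?a] bin_rec[of "\<lambda>i. ?a (Suc i)"] by (simp del: of_nat_Suc)
    then show ?thesis using centred_digits(1)[OF n c] centred_digits(2)[OF n c, of 1] that by simp
  qed
  show "bin (\<lambda>i. cyc w (m + int i)) \<ge> 27/64" if "n \<ge> 2" "w \<noteq> [1, 1, 0, 0]"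
  proof (cases "n = 2")
    case True
    then have w: "w = [0, 1, 1] \<and> m = 0 \<or> w = [0, 0, 1, 0, 0, 1, 1, 0, 1, 1] \<and> m = 4"
      using c that(2) by (auto simp: centred_def numeral_2_eq_2)
    show ?thesis by (rule bin_ge_011011) (use w in \<open>auto simp: cyc_def\<close>)
  next
    case False
    have "7/16 \<le> bin (\<lambda>i. cyc w (m + int i))"
      by (rule bin_ge_seven_sixteenths; rule centred_digits(2)[OF n c]) (use that(1) False in auto)
    then show ?thesis by simp
  qed
  show "bin (\<lambda>i. cyc w (m + int i)) = 2/5" if "w = [1, 1, 0, 0]"
  proof -
    \<comment> \<open>For positive \<open>n\<close> only the middle word of \<open>centred\<close>
      begins with 1.\<close>
    have "\<exists>n'. n = Suc n'" using n by presburger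
    then have m: "m = - 1" using c that by (auto simp: centred_def)
    have "cyc w (m + int i) = thue_morse (i mod 2 ^ 2)" for i
    proof -
      have "i mod 4 \<in> {0, 1, 2, 3}" by auto
      moreover have "(int i - 1) mod 4 = (if i mod 4 = 0 then 3 else int (i mod 4) - 1)" by presburger
      ultimately show ?thesis
        by (auto simp: cyc_def that m thue_morse_small)
    qed
    then show ?thesis using tm_number_2 unfolding tm_number_bin by simp
  qed
qed

text \<open>The centred border lies on an edge line, so the strip decides: its abscissa is at least
  27/64 and hence at least \<open>tm_number k\<close>, apart from the values 1/3 and 2/5, for which
  \<open>nk\<close> restricts \<open>k\<close>.\<close>

lemma special_cycles_meet_closure:
  assumes n: "n \<ge> 1" and w: "w \<in> special_words n" and k: "k \<ge> 1"
    and nk: "k = 1 \<or> n \<ge> 2 \<and> (k = 2 \<or> w \<noteq> [1, 1, 0, 0])"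
  shows "cycle_of_word w \<inter> closure (P k) \<noteq> {}"
proof -
  \<comment> \<open>For 10^n the border is read off the complement \<open>v\<close> = 01^n,
    otherwise \<open>v\<close> is \<open>w\<close>. The premise \<open>vw\<close> carries the
    exclusion of 1100 over to \<open>v\<close>.\<close>
  have x: "1/3 \<le> bin (\<lambda>i. cyc v (m + int i)) \<and> tm_number k \<le> bin (\<lambda>i. cyc v (m + int i))"
    if c: "centred n v m" and vw: "v = [1, 1, 0, 0] \<Longrightarrow> v = w" for v m
  proof (cases "v = [1, 1, 0, 0]")
    case True
    then have "k = 1 \<or> k = 2" using nk vw by blast
    then show ?thesis using centred_abscissa(3)[OF n c True] tm_number_1 tm_number_2 by auto
  next
    case False
    show ?thesis
    proof (cases "n = 1")
      case True
      then show ?thesis using centred_abscissa(1)[OF n c] nk tm_number_1 by auto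
    next
      case n1: False
      then have "27/64 \<le> bin (\<lambda>i. cyc v (m + int i))"
        using centred_abscissa(2)[OF n c] False n by simp
      moreover have "tm_number k \<le> 27/64"
        using tm_number_le[of k] tm_number_1 k by (cases "k = 1") auto
      ultimately show ?thesis by simp
    qed
  qed
  from w consider "w = 0 # replicate n 1 \<or> w = 1 # replicate n 0"
    | m where "centred n w m" "rev w = map (\<lambda>b. b + 1) w" "int (length w) dvd 2 * m + 2"
    unfolding special_words_def
  proof (elim insertE emptyE)
    assume w: "w = replicate n 1 @ replicate n 0"
    show ?thesis by (rule that(2)[of "- 1"]) (use w rev_halves(1) in \<open>auto simp: centred_def\<close>)
  next
    assume w: "w = replicate n 0 @ [1] @ replicate n 0 @ replicate n 1 @ [0] @ replicate n 1"
    show ?thesis by (rule that(2)[of "2 * int n"]) (use w rev_halves(2) in \<open>auto simp: centred_def add.commute\<close>)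
  qed (use that(1) in simp_all)
  then show ?thesis
  proof cases
    case 1
    have "centred n (0 # replicate n 1) 0" by (simp add: centred_def)
    from x[OF this] show ?thesis using 1 cyc_single_meets[OF n k] by auto
  next
    case (2 m)
    have "w \<noteq> []" "0 \<in> set w" "1 \<in> set w" using 2(1) n by (auto simp: centred_def)
    then show ?thesis
      using antipalindrome_meets[OF 2(2) _ _ _ 2(3)] centred_digits(1)[OF n 2(1)]
        centred_digits(2)[OF n 2(1), of 1] n k x[OF 2(1)] by simp
  qed
qed

lemma run_of_three:
  fixes u :: "int \<Rightarrow> bit"
  assumes "u (s + 1) = u s" "u (s + 2) = u s" "0 \<le> i" "i < 3"
  shows "u (s + i) = u s"
proof -
  have "i = 0 \<or> i = 1 \<or> i = 2" using assms(3,4) by linarith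
  then show ?thesis using assms by auto
qed

section \<open>Classification of the avoiding cycles and the trap property\<close>

theorem corollary4p2:
  shows
    "P 1 = interior (convex hull {(1/3, 2/3), (1/2, 1), (2/3, 1/3), (1/2, 0)})
     \<and> (\<forall>C. is_cycle C \<and> C \<inter> P 1 = {} \<longrightarrow>
            (\<exists>n\<ge>1. \<exists>w\<in>special_words n. C = cycle_of_word w))
     \<and> (\<forall>n\<ge>1. \<forall>w\<in>special_words n. cycle_of_word w \<inter> closure (P 1) \<noteq> {})
     \<and> cycle_trap (P 1)
     \<and> (\<forall>k\<ge>2. \<forall>C. is_cycle C \<and> C \<inter> P k = {} \<longrightarrow>
            (\<exists>n\<ge>1. \<exists>w\<in>special_words n. C = cycle_of_word w)
            \<or> C \<subseteq> coding ` bi_star {[0, 1], [0, 0, 1], [0, 1, 1], [0, 0, 1, 1]})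
     \<and> (\<forall>n\<ge>2. \<forall>w\<in>special_words n. \<forall>k\<ge>2. \<not> (k \<ge> 3 \<and> w = [1, 1, 0, 0]) \<longrightarrow>
            cycle_of_word w \<inter> closure (P k) \<noteq> {})"
proof (intro conjI)
  show "P 1 = interior (convex hull {(1/3, 2/3), (1/2, 1), (2/3, 1/3), (1/2, 0)})"
    unfolding convex_hull_parallelogram by (rule P_1_interior)
  show special_1: "\<forall>C. is_cycle C \<and> C \<inter> P 1 = {} \<longrightarrow>
      (\<exists>n\<ge>1. \<exists>w\<in>special_words n. C = cycle_of_word w)"
  proof (intro allI impI)
    fix C assume C: "is_cycle C \<and> C \<inter> P 1 = {}"
    obtain u where u: "periodic_mixed u" "C = range (\<lambda>m. coding (shift m u))"
      using C cycle_coding by blast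
    have av: "coding (shift m u) \<notin> P 1" for m using C u(2) by blast
    show "\<exists>n\<ge>1. \<exists>w\<in>special_words n. C = cycle_of_word w"
    \<comment> \<open>Two equal neighbours start a run of length 2; otherwise the digits
      alternate.\<close>
    proof (cases "\<exists>s. u (s + 1) = u s")
      case True
      then obtain s where s: "u (s + 1) = u s" by blast
      have "u (s + i) = u s" if "0 \<le> i" "i < int 2" for i
      proof -
        have "i = 0 \<or> i = 1" using that by auto
        then show ?thesis using s by auto
      qed
      then show ?thesis
        using avoiding_orbit_special[OF u(1) av, of 2 s] u(2) by simp
    next
      case False
      then have "C = cycle_of_word [1, 0]" using alternating_special[OF u(1)] u(2) by blast
      moreover have "[1, 0] \<in> special_words 1" by (simp add: special_words_def)
      ultimately show ?thesis by blast
    qed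
  qed
  show meet_1: "\<forall>n\<ge>1. \<forall>w\<in>special_words n. cycle_of_word w \<inter> closure (P 1) \<noteq> {}"
    using special_cycles_meet_closure[of _ _ 1] by simp
  show "cycle_trap (P 1)"
    unfolding cycle_trap_def
  proof (intro conjI notI)
    have "open (P 1)" unfolding P_1_interior by (rule open_interior)
    moreover have "P 1 = unit_square \<inter> P 1" by (auto simp: P_def)
    ultimately show "openin (top_of_set unit_square) (P 1)" using openin_open by blast
    assume "\<exists>C. is_cycle C \<and> C \<subseteq> survivor_set (closure (P 1))"
    then obtain C where C: "is_cycle C" "C \<subseteq> survivor_set (closure (P 1))" by blast
    \<comment> \<open>Shift 0 in the definition of the survivor set already keeps each point of
      \<open>C\<close> off the closure, whichever sequence codes it.\<close>
    have "C \<inter> closure (P 1) = {}"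
    proof -
      have "p \<notin> closure (P 1)" if "p \<in> C" for p
      proof -
        obtain u where "p = coding u" "\<forall>m. coding (shift m u) \<notin> closure (P 1)"
          using C(2) \<open>p \<in> C\<close> by (auto simp: survivor_set_def)
        then show ?thesis using shift_0 by metis
      qed
      then show ?thesis by blast
    qed
    moreover from this have "C \<inter> P 1 = {}" using closure_subset by blast
    ultimately show False using special_1 meet_1 C(1) by metis
  qed
  show "\<forall>k\<ge>2. \<forall>C. is_cycle C \<and> C \<inter> P k = {} \<longrightarrow>
      (\<exists>n\<ge>1. \<exists>w\<in>special_words n. C = cycle_of_word w)
      \<or> C \<subseteq> coding ` bi_star {[0, 1], [0, 0, 1], [0, 1, 1], [0, 0, 1, 1]}"
  proof (intro allI impI)
    fix k :: nat and C
    assume k: "k \<ge> 2" and C: "is_cycle C \<and> C \<inter> P k = {}"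
    obtain u where u: "periodic_mixed u" "C = range (\<lambda>m. coding (shift m u))"
      using C cycle_coding by blast
    have av: "coding (shift m u) \<notin> P k" for m using C u(2) by blast
    show "(\<exists>n\<ge>1. \<exists>w\<in>special_words n. C = cycle_of_word w)
        \<or> C \<subseteq> coding ` bi_star {[0, 1], [0, 0, 1], [0, 1, 1], [0, 0, 1, 1]}"
    \<comment> \<open>Three equal neighbours lead to a special cycle; if they never occur, every
      shift splits into the four words.\<close>
    proof (cases "\<exists>s. u (s + 1) = u s \<and> u (s + 2) = u s")
      case True
      then obtain s where "u (s + 1) = u s" "u (s + 2) = u s" by blast
      then have "u (s + i) = u s" if "0 \<le> i" "i < int 3" for i
        using run_of_three[of u s i] that by simp
      then show ?thesis
        using avoiding_orbit_special[OF u(1) av, of 3 s] u(2) k by simp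
    next
      case False
      have "shift m u \<in> bi_star {[0, 1], [0, 0, 1], [0, 1, 1], [0, 0, 1, 1]}" for m
      proof (rule no_triple_in_bi_star[OF periodic_mixed_shift[OF u(1)]])
        show "\<not> (shift m u (s + 1) = shift m u s \<and> shift m u (s + 2) = shift m u s)" for s
          using False[simplified, rule_format, of "s + m"] by (auto simp: shift_def algebra_simps)
      qed
      then show ?thesis unfolding u(2) by blast
    qed
  qed
  show "\<forall>n\<ge>2. \<forall>w\<in>special_words n. \<forall>k\<ge>2. \<not> (k \<ge> 3 \<and> w = [1, 1, 0, 0]) \<longrightarrow>
      cycle_of_word w \<inter> closure (P k) \<noteq> {}"
  proof (intro allI impI ballI)
    fix n w and k :: nat
    assume "2 \<le> n" "w \<in> special_words n" "2 \<le> k" "\<not> (3 \<le> k \<and> w = [1, 1, 0, 0])"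
    then show "cycle_of_word w \<inter> closure (P k) \<noteq> {}"
      by (intro special_cycles_meet_closure[of n]) auto
  qed
qed

end
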